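(* Fix any $r>0$ and any full-rank generator matrix $\mathbf{G}\in\mathbb{R}^{n\times n}$. There exists a rejection-sampled universal quantizer (RSUQ) $(P_S,Q)$ for the ball $rB^{n}$ against the Voronoi cell $\mathcal{V}$ of some lattice, with normalized entropy \[ \overline{H}(Q) \le -n\log r-\log\kappa_{n}-\frac{1-\delta(\mathbf{G})}{\delta(\mathbf{G})}\log(1-\delta(\mathbf{G})) \le -n\log r-\log\kappa_{n}+\log e, \] where $\delta(\mathbf{G})$ is the packing density of the lattice $\mathbf{G}\mathbb{Z}^n$. Since this RSUQ has error distribution $\mathrm{Unif}(rB^n)$ (that is, $Q(\mathbf{x},S)-\mathbf{x}\sim\mathrm{Unif}(rB^n)$ for every $\mathbf{x}\in\mathbb{R}^n$), it has maximum error $r$ and mean squared error $\mathbb{E}[\Vert Q(\mathbf{X},S)-\mathbf{X}\Vert^{2}]= nr^{2}/(n+2)$ (for any distribution of the random input $\mathbf{X}$, independent of $S\sim P_S$).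
   Context: Conventions: $\log$ is to base $2$; $0\log 0=0$; $\mu$ is Lebesgue measure on $\mathbb{R}^n$; $B^n=\{\mathbf{x}\in\mathbb{R}^n:\Vert\mathbf{x}\Vert\le 1\}$; $\kappa_n=\mu(B^n)$. Randomized quantizer: a pair $(P_S,Q)$ where $P_S$ is a probability distribution over a set $\mathcal{S}$ and $Q:\mathbb{R}^n\times\mathcal{S}\to\mathbb{R}^n$ is such that $\{Q(\mathbf{x},s):\mathbf{x}\in\mathbb{R}^n\}$ is finite or countable for every $s\in\mathcal{S}$. Its normalized entropy is $\overline{H}(Q):=\limsup_{\tau\to\infty}\big(H(Q(\mathbf{X}_\tau,S)|S)-\log\mu(\tau B^n)\big)$, where $\mathbf{X}_\tau\sim\mathrm{Unif}(\tau B^n)$ is independent of $S\sim P_S$ and $H(\cdot|\cdot)$ is conditional Shannon entropy in bits. Its maximum error is $\sup_{\mathbf{x}\in\mathbb{R}^n,\,s\in\mathcal{S}}\Vert Q(\mathbf{x},s)-\mathbf{x}\Vert$. Lattices: for a full-rank $\mathbf{G}\in\mathbb{R}^{n\times n}$, the lattice is $\mathbf{G}\mathbb{Z}^n=\{\mathbf{G}\mathbf{j}:\mathbf{j}\in\mathbb{Z}^n\}$; its packing radius is $\underline{\lambda}(\mathbf{G})=\frac12\min_{\mathbf{j}\in\mathbb{Z}^n\setminus\{\mathbf{0}\}}\Vert\mathbf{G}\mathbf{j}\Vert$ and its packing density is $\delta(\mathbf{G})=\underline{\lambda}(\mathbf{G})^n\kappa_n/|\det\mathbf{G}|$. A bounded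 set $\mathcal{P}\subseteq\mathbb{R}^n$ is a basic cell of $\mathbf{G}\mathbb{Z}^n$ if the translates $(\mathcal{P}+\mathbf{G}\mathbf{j})_{\mathbf{j}\in\mathbb{Z}^n}$ form a partition of $\mathbb{R}^n$. The Voronoi cell $\mathcal{V}=\{\mathbf{x}\in\mathbb{R}^n:\arg\min_{\mathbf{j}\in\mathbb{Z}^n}\Vert\mathbf{x}-\mathbf{G}\mathbf{j}\Vert=\mathbf{0}\}$ (ties broken in lexicographical order of $\mathbf{j}$) is a basic cell. For a basic cell $\mathcal{P}$, $Q_{\mathcal{P}}(\mathbf{x})$ is the unique lattice point $\mathbf{y}\in\mathbf{G}\mathbb{Z}^n$ with $\mathbf{x}\in-\mathcal{P}+\mathbf{y}$. RSUQ: for a basic cell $\mathcal{P}$ of a lattice and a subset $\mathcal{A}\subseteq\mathcal{P}$, the rejection-sampled universal quantizer for $\mathcal{A}$ against $\mathcal{P}$ is the randomized quantizer $(P_S,Q_{\mathcal{A},\mathcal{P}})$ with $S=(\mathbf{V}_i)_{i\ge1}$, where $\mathbf{V}_1,\mathbf{V}_2,\ldots$ are i.i.d. $\mathrm{Unif}(\mathcal{P})$, and $Q_{\mathcal{A},\mathcal{P}}(\mathbf{x},(\mathbf{v}_i)_i)=Q_{\mathcal{P}}(\mathbf{x}-\mathbf{v}_k)+\mathbf{v}_k$, where $k=\min\{i:Q_{\mathcal{P}}(\mathbf{x}-\mathbf{v}_i)+\mathbf{v}_i-\mathbf{x}\in\mathcal{A}\}$.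
   Formalization: The ball rB^n is required to lie in the Voronoi cell only up to a Lebesgue null set: with literal inclusion of the closed ball the claim fails for n=1, where the cell would be longer than 2r and the entropy would exceed -log(2r). *)

theory Defs
  imports "HOL-Probability.Probability" "HOL-Library.Fun_Lexorder"
begin

text \<open>
  Shannon entropy in bits of the discrete random variable \<^term>\<open>f\<close>. It takes values in
  \<^typ>\<open>ennreal\<close>, so that a divergent sum is infinite; the real-valued entropy of
  HOL-Probability would be \<open>0\<close> there. The convention \<open>0 log 0 = 0\<close> is built into
  multiplication by \<open>0\<close>.
\<close>

definition shannon_entropy :: "'a measure \<Rightarrow> ('a \<Rightarrow> 'b) \<Rightarrow> ennreal" where
  "shannon_entropy M f =
     (\<integral>\<^sup>+ y. (let p = measure M (f -` {y} \<inter> space M) in ennreal (- (p * log 2 p))) \<partial>count_space UNIV)"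

text \<open>
  A randomized quantizer is given by the seed set \<open>S\<close>, the seed law \<open>PS\<close> and the map \<open>Q\<close>.
  The set \<open>S\<close> has probability one but need not be all of \<^term>\<open>space PS\<close>, and need not be a
  measurable set: this is used to discard seeds on which a map \<open>Q\<close> is not defined.
\<close>

definition randomized_quantizer ::
  "'s set \<Rightarrow> 's measure \<Rightarrow> (real^'n \<Rightarrow> 's \<Rightarrow> real^'n) \<Rightarrow> bool" where
  "randomized_quantizer S PS Q \<longleftrightarrow>
     prob_space PS \<and> S \<subseteq> space PS \<and> (AE s in PS. s \<in> S) \<and>
     (\<lambda>(x, s). Q x s) \<in> borel_measurable (borel \<Otimes>\<^sub>M PS) \<and>
     (\<forall>s\<in>S. countable (range (\<lambda>x. Q x s)))"

text \<open>
  The conditional entropy \<open>H(Q(X,S) | S)\<close> for an input \<open>X\<close> with law \<open>PX\<close> independent of the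
  seed: by independence, the conditional law of \<open>Q(X,S)\<close> given \<open>S = s\<close> is the law of \<open>Q(X,s)\<close>.
\<close>

definition quantizer_entropy ::
  "(real^'n) measure \<Rightarrow> 's measure \<Rightarrow> (real^'n \<Rightarrow> 's \<Rightarrow> real^'n) \<Rightarrow> ennreal" where
  "quantizer_entropy PX PS Q = (\<integral>\<^sup>+ s. shannon_entropy PX (\<lambda>x. Q x s) \<partial>PS)"

definition normalized_entropy ::
  "'s measure \<Rightarrow> (real^'n \<Rightarrow> 's \<Rightarrow> real^'n) \<Rightarrow> ereal" where
  "normalized_entropy PS Q =
     Limsup at_top (\<lambda>\<tau>::real.
       enn2ereal (quantizer_entropy (uniform_measure lborel (cball 0 \<tau>)) PS Q)
         - ereal (log 2 (measure lborel (cball (0 :: real^'n) \<tau>))))"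

definition max_error :: "'s set \<Rightarrow> (real^'n \<Rightarrow> 's \<Rightarrow> real^'n) \<Rightarrow> ereal" where
  "max_error S Q = (SUP (x, s) \<in> UNIV \<times> S. ereal (norm (Q x s - x)))"

definition lattice_point :: "real^'n^'n \<Rightarrow> int^'n \<Rightarrow> real^'n" where
  "lattice_point G j = G *v (\<chi> i. real_of_int (j $ i))"

definition packing_radius :: "real^'n^'n \<Rightarrow> real" where
  "packing_radius G = (1/2) * (INF j \<in> - {0}. norm (lattice_point G j))"

definition packing_density :: "real^'n^'n \<Rightarrow> real" where
  "packing_density G =
     packing_radius G ^ CARD('n) * measure lborel (cball (0 :: real^'n) 1) / \<bar>det G\<bar>"

definition basic_cell :: "real^'n^'n \<Rightarrow> (real^'n) set \<Rightarrow> bool" where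
  "basic_cell G P \<longleftrightarrow>
     bounded P \<and>
     disjoint_family (\<lambda>j. (\<lambda>x. x + lattice_point G j) ` P) \<and>
     (\<Union>j. (\<lambda>x. x + lattice_point G j) ` P) = UNIV"

text \<open>
  \<open>j\<close> is the argument of the minimum of \<open>norm (x - G j)\<close>, where among several minimizers the
  lexicographically first is taken.
\<close>

definition nearest_index ::
  "real^'n::{finite,linorder}^'n::{finite,linorder} \<Rightarrow> real^'n::{finite,linorder} \<Rightarrow> int^'n::{finite,linorder} \<Rightarrow> bool" where
  "nearest_index G x j \<longleftrightarrow>
     (\<forall>k. k \<noteq> j \<longrightarrow>
        norm (x - lattice_point G j) < norm (x - lattice_point G k) \<or>
        norm (x - lattice_point G j) = norm (x - lattice_point G k) \<and> less_fun (($) j) (($) k))"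

definition voronoi_cell :: "real^'n::{finite,linorder}^'n::{finite,linorder} \<Rightarrow> (real^'n::{finite,linorder}) set" where
  "voronoi_cell G = {x. nearest_index G x 0}"

definition cell_quantizer :: "real^'n^'n \<Rightarrow> (real^'n) set \<Rightarrow> real^'n \<Rightarrow> real^'n" where
  "cell_quantizer G P x =
     (THE y. y \<in> range (lattice_point G) \<and> x \<in> (\<lambda>p. - p + y) ` P)"

definition rsuq_accepts ::
  "real^'n^'n \<Rightarrow> (real^'n) set \<Rightarrow> (real^'n) set \<Rightarrow> real^'n \<Rightarrow> real^'n \<Rightarrow> bool" where
  "rsuq_accepts G P A x v \<longleftrightarrow> cell_quantizer G P (x - v) + v - x \<in> A"

definition rsuq_map ::
  "real^'n^'n \<Rightarrow> (real^'n) set \<Rightarrow> (real^'n) set \<Rightarrow> real^'n \<Rightarrow> (nat \<Rightarrow> real^'n) \<Rightarrow> real^'n" where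
  "rsuq_map G P A x v =
     (let k = (LEAST i. rsuq_accepts G P A x (v i)) in cell_quantizer G P (x - v k) + v k)"

text \<open>
  The sequences in the cell for which the stopping index exists for every input. Outside this
  set \<^const>\<open>rsuq_map\<close> has an arbitrary value for some inputs.
\<close>

definition rsuq_seeds ::
  "real^'n^'n \<Rightarrow> (real^'n) set \<Rightarrow> (real^'n) set \<Rightarrow> (nat \<Rightarrow> real^'n) set" where
  "rsuq_seeds G P A = {v. (\<forall>i. v i \<in> P) \<and> (\<forall>x. \<exists>i. rsuq_accepts G P A x (v i))}"

definition rsuq_law :: "(real^'n) set \<Rightarrow> (nat \<Rightarrow> real^'n) measure" where
  "rsuq_law P = (\<Pi>\<^sub>M i\<in>UNIV. uniform_measure lborel P)"

text \<open>
  \<open>A\<close> is required to be a subset of \<open>P\<close> only up to a null set. A closed ball of radius equal to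
  the packing radius touches the Voronoi cell of the lattice in pairs of opposite boundary
  points, and the tie-breaking rule leaves at least one point of each such pair out of the cell.
  The quantizer itself depends only on \<open>A \<inter> P\<close>, because
  \<^term>\<open>cell_quantizer G P z - z\<close> always lies in \<open>P\<close>.
\<close>

definition is_rsuq ::
  "real^'n^'n \<Rightarrow> (real^'n) set \<Rightarrow> (real^'n) set \<Rightarrow>
   (nat \<Rightarrow> real^'n) set \<Rightarrow> (nat \<Rightarrow> real^'n) measure \<Rightarrow>
   (real^'n \<Rightarrow> (nat \<Rightarrow> real^'n) \<Rightarrow> real^'n) \<Rightarrow> bool" where
  "is_rsuq G A P S PS Q \<longleftrightarrow>
     rank G = CARD('n) \<and> basic_cell G P \<and> P \<in> sets borel \<and>
     A \<in> sets borel \<and> A - P \<in> null_sets lborel \<and>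
     S = rsuq_seeds G P A \<and> PS = rsuq_law P \<and> Q = rsuq_map G P A"

end

theory Submission
  imports Defs
begin

text \<open>The number K of rejected samples depends on the input as well as on the seed, and for a
  fixed seed its average over the input ball need not be (1 - \<delta>) / \<delta>. For this reason
  the reference law in Gibbs' inequality uses the same law of index and lattice point for every
  seed. The bound for one seed is then affine in K, so the integrals over input and seed can be
  exchanged, and for a fixed input the average of K over the seeds is exact.

  The factor \<delta> needs the volume of the Voronoi cell, which has no convenient closed
  description. Any two basic cells of a lattice can be cut into pieces that are lattice translates
  of each other, so its volume is that of the half-open parallelepiped spanned by the generator,
  namely the absolute determinant. The same cutting argument shows that, for a fixed input, the
  error of one proposal is uniform on the cell.

  Only the open ball is known to lie inside the Voronoi cell. Volumes ignore the sphere, but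
  pointwise claims, such as the attainable errors or acceptance for all inputs, are argued inside
  the open ball.\<close>

text \<open>
  Scale \<open>G\<close> so that its packing radius becomes \<open>r\<close>; then the ball is contained in the Voronoi
  cell up to a null set and fills the fraction \<open>\<delta>\<close> of it. For every input the reduction modulo
  the lattice maps a uniform point of the cell to a uniform point of the cell, so the first
  accepted error is uniform on the ball and the stopping index \<open>K\<close> is geometric with parameter
  \<open>\<delta>\<close>, whence \<open>E K = (1 - \<delta>) / \<delta>\<close>.

  For the entropy, given the seed, the output is determined by \<open>K\<close> and a lattice point.
  Gibbs' inequality against the product of the geometric law and the uniform law on the \<open>N\<close>
  lattice points that are within reach of the input ball gives
  \<open>H \<le> log N - log \<delta> - E K log (1 - \<delta>)\<close>, and \<open>N\<close> is asymptotically the volume of the input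
  ball divided by the volume of the cell.
\<close>

section \<open>Entropy and Gibbs' inequality\<close>

text \<open>Passes from an integral over \<open>M\<close> to the sum over values used in
  \<open>shannon_entropy\<close>. Exchanging sum and integral needs countably many fibres, so the
  sum runs over \<open>R\<close> first; outside \<open>R\<close> the fibres are empty.\<close>

lemma nn_integral_countable_range:
  assumes R: "countable R" "\<And>x. x \<in> space M \<Longrightarrow> f x \<in> R"
    and f: "\<And>y. f -` {y} \<inter> space M \<in> sets M"
  shows "(\<integral>\<^sup>+x. u (f x) \<partial>M) = (\<integral>\<^sup>+y. u y * emeasure M (f -` {y} \<inter> space M) \<partial>count_space UNIV)"
proof -
  have "(\<integral>\<^sup>+x. u (f x) \<partial>M) = (\<integral>\<^sup>+x. \<integral>\<^sup>+y. u y * indicator (f -` {y} \<inter> space M) x \<partial>count_space R \<partial>M)"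
  proof (rule nn_integral_cong)
    fix x assume x: "x \<in> space M"
    have "(\<integral>\<^sup>+y. u y * indicator (f -` {y} \<inter> space M) x \<partial>count_space R)
        = (\<integral>\<^sup>+y. u (f x) * indicator {f x} y \<partial>count_space R)"
      using x by (intro nn_integral_cong) (auto split: split_indicator)
    also have "\<dots> = u (f x)"
      using R(2)[OF x] by (subst nn_integral_cmult_indicator) auto
    finally show "u (f x) = (\<integral>\<^sup>+y. u y * indicator (f -` {y} \<inter> space M) x \<partial>count_space R)" ..
  qed
  also have "\<dots> = (\<integral>\<^sup>+y. \<integral>\<^sup>+x. u y * indicator (f -` {y} \<inter> space M) x \<partial>M \<partial>count_space R)"
    using f by (intro nn_integral_count_space_nn_integral R) auto
  also have "\<dots> = (\<integral>\<^sup>+y. u y * emeasure M (f -` {y} \<inter> space M) \<partial>count_space R)"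
    using f by (intro nn_integral_cong nn_integral_cmult_indicator)
  also have "\<dots> = (\<integral>\<^sup>+y. u y * emeasure M (f -` {y} \<inter> space M) \<partial>count_space UNIV)"
  proof -
    have "f -` {y} \<inter> space M = {}" if "y \<notin> R" for y
      using that R(2) by auto
    then show ?thesis
      by (subst nn_integral_count_space_indicator)
        (auto intro!: nn_integral_cong split: split_indicator)
  qed
  finally show ?thesis .
qed

text \<open>This is ln t <= t - 1 at t = w / p, multiplied by p. The correction terms are kept as
  summands on both sides because the inequality is later summed in \<open>ennreal\<close>, where
  subtraction truncates.\<close>

lemma neg_log_gibbs:
  fixes p w :: real
  assumes "p \<ge> 0" "w > 0"
  shows "- (p * log 2 p) + p / ln 2 \<le> p * (- log 2 w) + w / ln 2"
proof (cases "p = 0")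
  case False
  then have "p > 0" using assms by simp
  have "ln (w / p) \<le> w / p - 1"
    using \<open>p > 0\<close> assms by (intro ln_le_minus_one) auto
  then have "p * (ln w - ln p) \<le> w - p"
    using \<open>p > 0\<close> assms by (simp add: ln_div field_simps)
  then have "p * (ln w - ln p) / ln 2 \<le> (w - p) / ln 2"
    by (intro divide_right_mono) auto
  then show ?thesis
    by (simp add: log_def field_simps)
qed (use assms in auto)

text \<open>Summing \<open>neg_log_gibbs\<close> over all values, the two correction terms each
  total 1 / ln 2, as both laws have mass 1. Being finite, they cancel even when the entropies are
  infinite.\<close>

lemma shannon_entropy_le_pmf:
  fixes q :: "'b pmf"
  assumes M: "prob_space M"
    and R: "countable R" "\<And>x. x \<in> space M \<Longrightarrow> f x \<in> R"
    and f: "\<And>y. f -` {y} \<inter> space M \<in> sets M"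
    and q: "AE x in M. pmf q (f x) > 0"
  shows "shannon_entropy M f \<le> (\<integral>\<^sup>+x. ennreal (- log 2 (pmf q (f x))) \<partial>M)"
proof -
  interpret prob_space M by fact
  define p where "p y = measure M (f -` {y} \<inter> space M)" for y
  have em: "emeasure M (f -` {y} \<inter> space M) = ennreal (p y)" for y
    unfolding p_def by (simp add: emeasure_eq_measure)
  have p: "0 \<le> p y" "p y \<le> 1" for y
    unfolding p_def by auto
  \<comment> \<open>Since \<open>log 2 0\<close> is 0, a value outside the support of
    \<open>q\<close> would be charged nothing; such values must have probability 0.\<close>
  have pos: "pmf q y > 0" if "p y \<noteq> 0" for y
  proof (rule ccontr)
    assume "\<not> pmf q y > 0"
    with q have "AE x in M. x \<notin> f -` {y} \<inter> space M"
      by (auto elim!: eventually_mono)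
    then have "prob (f -` {y} \<inter> space M) = 0"
      using prob_eq_0[OF f] by simp
    with that show False by (simp add: p_def)
  qed
  have sum1: "(\<integral>\<^sup>+y. ennreal (p y) \<partial>count_space UNIV) = 1"
    using nn_integral_countable_range[OF R f, where u = "\<lambda>_. 1"] emeasure_space_1
    by (simp add: em)
  have pw: "ennreal (- (p y * log 2 (p y))) + ennreal (1 / ln 2) * ennreal (p y)
     \<le> ennreal (- log 2 (pmf q y)) * ennreal (p y) + ennreal (1 / ln 2) * ennreal (pmf q y)" for y
  proof (cases "p y = 0")
    case False
    have a: "- (p y * log 2 (p y)) \<ge> 0"
      using p[of y] False by (simp add: mult_le_0_iff)
    have b: "- log 2 (pmf q y) \<ge> 0"
      using pos[OF False] by (simp add: pmf_le_1)
    have "- (p y * log 2 (p y)) + p y / ln 2 \<le> p y * (- log 2 (pmf q y)) + pmf q y / ln 2"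
      using pos[OF False] p by (intro neg_log_gibbs) auto
    then have "ennreal (- (p y * log 2 (p y)) + p y / ln 2) \<le> ennreal (p y * (- log 2 (pmf q y)) + pmf q y / ln 2)"
      by (rule ennreal_leI)
    moreover have "ennreal (- (p y * log 2 (p y)) + p y / ln 2) = ennreal (- (p y * log 2 (p y))) + ennreal (1 / ln 2) * ennreal (p y)"
      using a p[of y] by (subst ennreal_plus) (auto simp: ennreal_mult[symmetric])
    moreover have "ennreal (p y * (- log 2 (pmf q y)) + pmf q y / ln 2)
        = ennreal (- log 2 (pmf q y)) * ennreal (p y) + ennreal (1 / ln 2) * ennreal (pmf q y)"
      using b p[of y] mult_nonneg_nonneg[OF p(1)[of y] b]
      by (subst ennreal_plus) (auto simp: ennreal_mult[symmetric] mult.commute)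
    ultimately show ?thesis by simp
  qed auto
  have "shannon_entropy M f + ennreal (1 / ln 2)
      = (\<integral>\<^sup>+y. ennreal (- (p y * log 2 (p y))) + ennreal (1 / ln 2) * ennreal (p y) \<partial>count_space UNIV)"
    unfolding shannon_entropy_def Let_def p_def[symmetric]
    by (simp add: nn_integral_add nn_integral_cmult sum1)
  also have "\<dots> \<le> (\<integral>\<^sup>+y. ennreal (- log 2 (pmf q y)) * ennreal (p y) + ennreal (1 / ln 2) * ennreal (pmf q y) \<partial>count_space UNIV)"
    by (intro nn_integral_mono pw)
  also have "\<dots> = (\<integral>\<^sup>+x. ennreal (- log 2 (pmf q (f x))) \<partial>M) + ennreal (1 / ln 2)"
    using nn_integral_countable_range[OF R f, where u = "\<lambda>y. ennreal (- log 2 (pmf q y))"]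
    by (simp add: nn_integral_add nn_integral_cmult nn_integral_pmf em)
  finally show ?thesis
    by (simp add: ennreal_add_left_cancel_le add.commute)
qed

section \<open>Rejection sampling\<close>

text \<open>Indices start at 0, so this counts the misses before the first hit. Without any hit the
  value is arbitrary.\<close>

definition first_hit :: "'a set \<Rightarrow> (nat \<Rightarrow> 'a) \<Rightarrow> nat" where
  "first_hit E v = (LEAST i. v i \<in> E)"

lemma first_hit_in: "\<exists>i. v i \<in> E \<Longrightarrow> v (first_hit E v) \<in> E"
  unfolding first_hit_def by (rule LeastI_ex)

lemma first_hit_eq_iff:
  "v (first_hit E v) \<in> E \<Longrightarrow> first_hit E v = k \<longleftrightarrow> (\<forall>i<k. v i \<notin> E) \<and> v k \<in> E"
  unfolding first_hit_def by (metis (no_types, lifting) LeastI not_less_Least linorder_neqE_nat)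

locale iid_sequence = prob_space M for M :: "'a measure" +
  fixes E :: "'a set"
  assumes E[measurable]: "E \<in> sets M"
begin

abbreviation "seqs \<equiv> \<Pi>\<^sub>M i\<in>(UNIV :: nat set). M"

sublocale PP: product_prob_space "\<lambda>_. M" "UNIV :: nat set" ..

text \<open>A cylinder event with \<open>k\<close> misses followed by a free condition
  \<open>B\<close>. Keeping \<open>B\<close> separate from \<open>E\<close> covers both the tail
  event (\<open>B\<close> the whole space) and a first hit landing in a given set.\<close>

lemma emeasure_first_hits:
  assumes [measurable]: "B \<in> sets M"
  shows "emeasure seqs {v\<in>space seqs. (\<forall>i<k. v i \<notin> E) \<and> v k \<in> B} = ennreal ((1 - prob E) ^ k) * emeasure M B"
proof -
  let ?X = "\<lambda>i. if i < k then space M - E else B"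
  have "{v\<in>space seqs. (\<forall>i<k. v i \<notin> E) \<and> v k \<in> B} = {v\<in>space seqs. \<forall>i\<in>{..k}. v i \<in> ?X i}"
    by (auto simp: space_PiM Ball_def le_less)
  also have "emeasure seqs \<dots> = (\<Prod>i\<in>{..k}. emeasure M (?X i))"
    by (rule PP.emeasure_PiM_Collect) auto
  also have "\<dots> = (\<Prod>i<k. emeasure M (space M - E)) * emeasure M B"
    by (simp add: lessThan_Suc_atMost[symmetric])
  also have "\<dots> = ennreal ((1 - prob E) ^ k) * emeasure M B"
    by (simp add: emeasure_eq_measure prob_compl ennreal_power)
  finally show ?thesis .
qed

lemma emeasure_no_hits:
  "emeasure seqs {v\<in>space seqs. (\<forall>i<k. v i \<notin> E)} = ennreal ((1 - prob E) ^ k)"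
proof -
  have "{v\<in>space seqs. (\<forall>i<k. v i \<notin> E)} = {v\<in>space seqs. (\<forall>i<k. v i \<notin> E) \<and> v k \<in> space M}"
    by (auto simp: space_PiM)
  then show ?thesis
    using emeasure_first_hits[of "space M" k] by (simp add: emeasure_space_1)
qed

text \<open>Never hitting implies missing the first \<open>k\<close> times for every
  \<open>k\<close>, and those probabilities decay geometrically.\<close>

lemma AE_hit:
  assumes "prob E > 0"
  shows "AE v in seqs. \<exists>i. v i \<in> E"
proof -
  let ?N = "{v\<in>space seqs. \<forall>i. v i \<notin> E}"
  have [measurable]: "?N \<in> sets seqs"
    by measurable
  have "PP.P.prob ?N \<le> (1 - prob E) ^ k" for k
  proof -
    have "PP.P.prob ?N \<le> PP.P.prob {v\<in>space seqs. (\<forall>i<k. v i \<notin> E)}"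
      by (rule PP.P.finite_measure_mono) auto
    also have "\<dots> = (1 - prob E) ^ k"
      using emeasure_no_hits[of k] prob_le_1[of E] unfolding PP.P.emeasure_eq_measure
      by (subst (asm) ennreal_inj) auto
    finally show ?thesis .
  qed
  moreover have "(\<lambda>k. (1 - prob E) ^ k) \<longlonglongrightarrow> 0"
    using assms by (intro LIMSEQ_power_zero) (simp add: abs_if, use prob_le_1[of E] in linarith)
  ultimately have "PP.P.prob ?N \<le> 0"
    by (intro LIMSEQ_le_const[of "\<lambda>k. (1 - prob E) ^ k"]) auto
  then have "PP.P.prob ?N = 0"
    by (simp add: measure_le_0_iff)
  then have "AE v in seqs. v \<notin> ?N"
    using PP.P.prob_eq_0[of ?N] by simp
  then show ?thesis
    by (auto elim: eventually_mono intro: AE_mp[OF AE_space])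
qed

lemma measurable_first_hit[measurable]: "first_hit E \<in> measurable seqs (count_space UNIV)"
  unfolding first_hit_def by measurable

lemma measurable_at_first_hit[measurable]: "(\<lambda>v. v (first_hit E v)) \<in> measurable seqs M"
  by (rule measurable_compose_countable[where f = "\<lambda>i v. v i"]) measurable

text \<open>Rejection sampling: splitting by the index of the first hit, every index contributes the
  measure of \<open>E \<inter> B\<close> times a geometric weight, and the weights sum to
  \<open>1 / prob E\<close>, the normalization of the conditional law.\<close>

lemma distr_at_first_hit:
  assumes pos: "prob E > 0"
  shows "distr seqs M (\<lambda>v. v (first_hit E v)) = uniform_measure M E"
proof (rule measure_eqI)
  fix B assume "B \<in> sets (distr seqs M (\<lambda>v. v (first_hit E v)))"
  then have B[measurable]: "B \<in> sets M" by simp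
  have "emeasure (distr seqs M (\<lambda>v. v (first_hit E v))) B = emeasure seqs ((\<lambda>v. v (first_hit E v)) -` B \<inter> space seqs)"
    by (rule emeasure_distr) measurable
  also have "\<dots> = emeasure seqs (\<Union>k. {v\<in>space seqs. (\<forall>i<k. v i \<notin> E) \<and> v k \<in> E \<inter> B})"
  proof (rule emeasure_eq_AE)
    show "AE v in seqs. v \<in> (\<lambda>v. v (first_hit E v)) -` B \<inter> space seqs \<longleftrightarrow>
        v \<in> (\<Union>k. {v\<in>space seqs. (\<forall>i<k. v i \<notin> E) \<and> v k \<in> E \<inter> B})"
      using AE_hit[OF pos] AE_space
    proof eventually_elim
      case (elim v)
      show ?case
      proof -
        have h: "v (first_hit E v) \<in> E"
          by (rule first_hit_in) fact
        have "v (first_hit E v) \<in> B \<longleftrightarrow> (\<exists>k. first_hit E v = k \<and> v k \<in> B)"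
          by simp
        then show ?thesis
          unfolding first_hit_eq_iff[of v E, OF h] using elim(2) by simp
      qed
    qed
  qed measurable
  also have "\<dots> = (\<Sum>k. emeasure seqs {v\<in>space seqs. (\<forall>i<k. v i \<notin> E) \<and> v k \<in> E \<inter> B})"
  proof (rule suminf_emeasure[symmetric])
    show "disjoint_family (\<lambda>k. {v\<in>space seqs. (\<forall>i<k. v i \<notin> E) \<and> v k \<in> E \<inter> B})"
      by (auto simp: disjoint_family_on_def) (metis linorder_neqE_nat)
  qed auto
  also have "\<dots> = (\<Sum>k. ennreal ((1 - prob E) ^ k) * emeasure M (E \<inter> B))"
    by (intro suminf_cong emeasure_first_hits) auto
  also have "\<dots> = ennreal (1 / prob E) * emeasure M (E \<inter> B)"
  proof -
    have "(\<lambda>k. (1 - prob E) ^ k) sums (1 / (1 - (1 - prob E)))"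
      using pos by (intro geometric_sums) (simp add: abs_if, use prob_le_1[of E] in linarith)
    then have "(\<Sum>k. ennreal ((1 - prob E) ^ k)) = ennreal (1 / prob E)"
      by (intro sums_unique[symmetric]) (simp add: sums_ennreal)
    then show ?thesis by simp
  qed
  also have "\<dots> = emeasure M (E \<inter> B) / emeasure M E"
    using pos by (simp add: emeasure_eq_measure ennreal_mult[symmetric] divide_ennreal)
  finally show "emeasure (distr seqs M (\<lambda>v. v (first_hit E v))) B = emeasure (uniform_measure M E) B"
    by simp
qed simp

text \<open>The mean is the sum of the tail probabilities, again a geometric series.\<close>

lemma nn_integral_first_hit:
  assumes pos: "prob E > 0"
  shows "(\<integral>\<^sup>+v. ennreal (real (first_hit E v)) \<partial>seqs) = ennreal ((1 - prob E) / prob E)"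
proof -
  have "(\<integral>\<^sup>+v. ennreal (real (first_hit E v)) \<partial>seqs) = (\<integral>\<^sup>+v. (\<Sum>k. indicator {v\<in>space seqs. \<forall>i<Suc k. v i \<notin> E} v) \<partial>seqs)"
  proof (rule nn_integral_cong_AE)
    show "AE v in seqs. ennreal (real (first_hit E v)) = (\<Sum>k. indicator {v\<in>space seqs. \<forall>i<Suc k. v i \<notin> E} v)"
      using AE_hit[OF pos] AE_space
    proof eventually_elim
      case (elim v)
      \<comment> \<open>The index exceeds \<open>k\<close> exactly if the \<open>k + 1\<close>
        samples with indices 0 to \<open>k\<close> all miss; hence the extra factor
        \<open>1 - prob E\<close> in the series.\<close>
      have *: "(\<forall>i<Suc k. v i \<notin> E) \<longleftrightarrow> k < first_hit E v" for k
        using first_hit_in[OF elim(1)] unfolding first_hit_def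
        by (metis (no_types, lifting) less_Suc_eq_le not_less not_less_Least order_le_less_trans)
      have "(\<Sum>k. indicator {v\<in>space seqs. \<forall>i<Suc k. v i \<notin> E} v) = (\<Sum>k. (if k < first_hit E v then 1 else 0 :: ennreal))"
        using elim(2) by (intro suminf_cong) (simp only: indicator_def mem_Collect_eq * simp_thms of_bool_def)
      also have "\<dots> = (\<Sum>k<first_hit E v. (if k < first_hit E v then 1 else 0 :: ennreal))"
        by (rule suminf_finite) auto
      also have "\<dots> = ennreal (real (first_hit E v))"
        by (simp add: ennreal_of_nat_eq_real_of_nat)
      finally show ?case ..
    qed
  qed
  also have "\<dots> = (\<Sum>k. emeasure seqs {v\<in>space seqs. \<forall>i<Suc k. v i \<notin> E})"
    by (subst nn_integral_suminf) (auto intro!: suminf_cong nn_integral_indicator)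
  also have "\<dots> = (\<Sum>k. ennreal ((1 - prob E) * (1 - prob E) ^ k))"
    by (subst emeasure_no_hits) simp
  also have "\<dots> = ennreal ((1 - prob E) / prob E)"
  proof -
    have "(\<lambda>k. (1 - prob E) * (1 - prob E) ^ k) sums ((1 - prob E) * (1 / (1 - (1 - prob E))))"
      using pos by (intro sums_mult geometric_sums) (simp add: abs_if, use prob_le_1[of E] in linarith)
    then show ?thesis
      by (intro sums_unique[symmetric]) (simp add: sums_ennreal)
  qed
  finally show ?thesis .
qed

end

section \<open>Volumes\<close>

text \<open>Writing r^2 - |x|^2 as the integral of 2 t over t from |x| to r turns the complementary
  integral \<open>?J\<close> into an integral of volumes of concentric balls. The second moment
  \<open>?I\<close> is what remains of r^2 times the volume.\<close>

lemma nn_integral_norm_sq_ball: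
  fixes r :: real
  defines "n \<equiv> real DIM('a::euclidean_space)"
  assumes r: "r > 0"
  shows "(\<integral>\<^sup>+x. ennreal ((norm x)\<^sup>2) \<partial>uniform_measure lborel (cball (0::'a) r)) = ennreal (n * r\<^sup>2 / (n + 2))"
proof -
  define d where "d = DIM('a)"
  define K where "K = unit_ball_vol (real d)"
  have K: "K > 0" unfolding K_def by (simp add: unit_ball_vol_pos)
  have vol: "emeasure lborel (cball (0::'a) t) = ennreal (K * t ^ d)" if "t \<ge> 0" for t
    using that unfolding K_def d_def by (rule emeasure_cball)
  let ?I = "\<integral>\<^sup>+x. ennreal ((norm x)\<^sup>2) * indicator (cball (0::'a) r) x \<partial>lborel"
  let ?J = "\<integral>\<^sup>+x. ennreal (r\<^sup>2 - (norm x)\<^sup>2) * indicator (cball (0::'a) r) x \<partial>lborel"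
  have [measurable]: "cball (0::'a) r \<in> sets borel"
    by simp
  have m: "(\<lambda>x::'a. ennreal ((norm x)\<^sup>2) * indicator (cball 0 r) x) \<in> borel_measurable borel"
    "(\<lambda>x::'a. ennreal (r\<^sup>2 - (norm x)\<^sup>2) * indicator (cball 0 r) x) \<in> borel_measurable borel"
    by measurable
  have "?I + ?J = (\<integral>\<^sup>+x. ennreal (r\<^sup>2) * indicator (cball (0::'a) r) x \<partial>lborel)"
    using m by (subst nn_integral_add[symmetric])
       (auto intro!: nn_integral_cong split: split_indicator simp: ennreal_plus[symmetric] power_mono
          simp del: ennreal_plus)
  also have "\<dots> = ennreal (r\<^sup>2 * (K * r ^ d))"
    using r K by (subst nn_integral_cmult_indicator) (auto simp: vol ennreal_mult)
  finally have IJ: "?I + ?J = ennreal (r\<^sup>2 * (K * r ^ d))" .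
  have "?J = (\<integral>\<^sup>+x. \<integral>\<^sup>+t. ennreal (2 * t) * indicator {0..r} t * indicator (cball (0::'a) t) x \<partial>lborel \<partial>lborel)"
  proof (rule nn_integral_cong)
    fix x :: 'a
    have "(\<integral>\<^sup>+t. ennreal (2 * t) * indicator {0..r} t * indicator (cball (0::'a) t) x \<partial>lborel)
      = (\<integral>\<^sup>+t. ennreal (2 * t) * indicator {norm x..r} t \<partial>lborel)"
      by (intro nn_integral_cong) (auto split: split_indicator intro: order_trans[of 0 "norm x"])
    also have "\<dots> = ennreal (r\<^sup>2 - (norm x)\<^sup>2) * indicator (cball (0::'a) r) x"
    proof (cases "norm x \<le> r")
      case True
      then show ?thesis
        by (subst nn_integral_FTC_Icc[where F = "\<lambda>t. t\<^sup>2"])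
          (auto intro!: derivative_eq_intros intro: order_trans[of 0 "norm x"])
    qed auto
    finally show "ennreal (r\<^sup>2 - (norm x)\<^sup>2) * indicator (cball (0::'a) r) x
      = (\<integral>\<^sup>+t. ennreal (2 * t) * indicator {0..r} t * indicator (cball (0::'a) t) x \<partial>lborel)" ..
  qed
  also have "\<dots> = (\<integral>\<^sup>+t. \<integral>\<^sup>+x. ennreal (2 * t) * indicator {0..r} t * indicator (cball (0::'a) t) x \<partial>lborel \<partial>lborel)"
  proof -
    \<comment> \<open>Joint measurability in radius and point: the balls are the sections of a
      closed cone.\<close>
    have [measurable]: "{x :: real \<times> 'a. norm (snd x) \<le> fst x} \<in> sets borel"
      by (intro borel_closed closed_Collect_le continuous_intros)
    have "indicator (cball 0 t) x = (indicator {x :: real \<times> 'a. norm (snd x) \<le> fst x} (t, x) :: ennreal)" for t :: real and x :: 'a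
      by (auto split: split_indicator)
    then show ?thesis
      by (simp only:) (intro lborel_pair.Fubini', auto simp: borel_prod[symmetric])
  qed
  also have "\<dots> = (\<integral>\<^sup>+t. ennreal (2 * K * t ^ (d + 1)) * indicator {0..r} t \<partial>lborel)"
  proof (rule nn_integral_cong)
    fix t :: real
    have "(\<integral>\<^sup>+x. ennreal (2 * t) * indicator {0..r} t * indicator (cball (0::'a) t) x \<partial>lborel)
      = ennreal (2 * t) * indicator {0..r} t * emeasure lborel (cball (0::'a) t)"
      by (subst nn_integral_cmult_indicator) auto
    also have "\<dots> = ennreal (2 * K * t ^ (d + 1)) * indicator {0..r} t"
      using K by (auto split: split_indicator simp: vol ennreal_mult[symmetric] algebra_simps)
    finally show "(\<integral>\<^sup>+x. ennreal (2 * t) * indicator {0..r} t * indicator (cball (0::'a) t) x \<partial>lborel)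
      = ennreal (2 * K * t ^ (d + 1)) * indicator {0..r} t" .
  qed
  also have "\<dots> = ennreal (2 * K * r ^ (d + 2) / real (d + 2))"
    using r K
    by (subst nn_integral_FTC_Icc[where F = "\<lambda>t. 2 * K * t ^ (d + 2) / real (d + 2)"])
       (auto intro!: derivative_eq_intros simp del: power_Suc)
  finally have J: "?J = ennreal (2 * K * r ^ (d + 2) / real (d + 2))" .
  have "?I + ?J = ennreal (K * r ^ d * (n * r\<^sup>2 / (n + 2))) + ?J"
  proof -
    have "r\<^sup>2 * (K * r ^ d) = K * r ^ d * (n * r\<^sup>2 / (n + 2)) + 2 * K * r ^ (d + 2) / real (d + 2)"
    proof -
      define D where "D = real (d + 2)"
      have D: "D \<noteq> 0" "n = D - 2"
        by (simp_all add: D_def n_def d_def)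
      show ?thesis
        unfolding D_def[symmetric] D(2) using D(1) by (simp add: field_simps power2_eq_square)
    qed
    then show ?thesis
      unfolding IJ unfolding J using K r by (simp add: n_def flip: ennreal_plus)
  qed
  \<comment> \<open>\<open>?J\<close> is finite and can therefore be cancelled in
    \<open>ennreal\<close>.\<close>
  then have "?J + ?I = ?J + ennreal (K * r ^ d * (n * r\<^sup>2 / (n + 2)))"
    by (simp only: add.commute)
  then have I: "?I = ennreal (K * r ^ d * (n * r\<^sup>2 / (n + 2)))"
    unfolding ennreal_add_left_cancel by (simp add: J)
  have "(\<integral>\<^sup>+x. ennreal ((norm x)\<^sup>2) \<partial>uniform_measure lborel (cball (0::'a) r)) = ?I / ennreal (K * r ^ d)"
    using r by (subst nn_integral_uniform_measure) (auto simp: vol)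
  also have "\<dots> = ennreal (n * r\<^sup>2 / (n + 2))"
    unfolding I using r K by (subst divide_ennreal) (auto simp: n_def)
  finally show ?thesis .
qed

section \<open>Linear images scale volume by the determinant\<close>

lemma det_shear:
  fixes m k :: "'n::finite"
  assumes "m \<noteq> k"
  shows "det (matrix (\<lambda>x :: real^'n. \<chi> i. if i = m then x $ m + x $ k else x $ i)) = 1"
proof -
  let ?I = "mat 1 :: real^'n^'n"
  have "matrix (\<lambda>x :: real^'n. \<chi> i. if i = m then x $ m + x $ k else x $ i)
      = (\<chi> i. if i = m then row m ?I + 1 *s row k ?I else row i ?I)"
    by (auto simp: vec_eq_iff matrix_def row_def mat_def axis_def)
  then show ?thesis
    by (simp only: det_row_operation[OF assms] det_I)
qed

text \<open>The library has this only for wellordered index types.\<close>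

lemma measure_linear_image_cart:
  fixes f :: "real^'n \<Rightarrow> real^'n"
  assumes "linear f" "S \<in> lmeasurable"
  shows "f ` S \<in> lmeasurable \<and> measure lebesgue (f ` S) = \<bar>det (matrix f)\<bar> * measure lebesgue S"
proof -
  \<comment> \<open>The property is closed under composition, so it suffices to check the elementary
    maps: singular ones, stretches, coordinate swaps and shears.\<close>
  define Q where "Q f \<longleftrightarrow> linear f \<and> (\<forall>S\<in>lmeasurable. f ` S \<in> lmeasurable \<and>
      measure lebesgue (f ` S) = \<bar>det (matrix f)\<bar> * measure lebesgue S)" for f :: "real^'n \<Rightarrow> real^'n"
  have comp: "Q (f \<circ> g)" if "Q f" "Q g" for f g
    unfolding Q_def
  proof (intro conjI ballI)
    show "linear (f \<circ> g)"
      using that by (auto simp: Q_def intro: linear_compose)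
    fix S :: "(real^'n) set" assume S: "S \<in> lmeasurable"
    have g: "g ` S \<in> lmeasurable" "measure lebesgue (g ` S) = \<bar>det (matrix g)\<bar> * measure lebesgue S"
      using \<open>Q g\<close> S by (auto simp: Q_def)
    have f: "f ` g ` S \<in> lmeasurable" "measure lebesgue (f ` g ` S) = \<bar>det (matrix f)\<bar> * measure lebesgue (g ` S)"
      using \<open>Q f\<close> g(1) by (auto simp: Q_def)
    have "matrix (f \<circ> g) = matrix f ** matrix g"
      using that by (intro matrix_compose) (auto simp: Q_def)
    then show "(f \<circ> g) ` S \<in> lmeasurable"
      "measure lebesgue ((f \<circ> g) ` S) = \<bar>det (matrix (f \<circ> g))\<bar> * measure lebesgue S"
      using f g(2) by (simp_all only: image_comp[symmetric] det_mul abs_mult mult.assoc)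
  qed
  have stretch: "Q (\<lambda>x. \<chi> i. c i * x $ i)" for c
    unfolding Q_def
    by (simp add: measurable_stretch measure_stretch matrix_def axis_def det_diagonal)
       (rule linearI; simp add: vec_eq_iff algebra_simps)
  have shear: "Q (\<lambda>x. \<chi> i. if i = m then x $ m + x $ k else x $ i)" if "m \<noteq> k" for m k
  proof -
    let ?h = "\<lambda>x :: real^'n. \<chi> i. if i = m then x $ m + x $ k else x $ i"
    have lin: "linear ?h"
      by (rule linearI) (auto simp: vec_eq_iff algebra_simps)
    \<comment> \<open>The box is first moved so that its lower corner is 0; by linearity this only
      translates its image.\<close>
    have box: "measure lebesgue (?h ` cbox a b) = 1 * measure lebesgue (cbox a b)" for a b
    proof (cases "cbox a b = {}")
      case False
      have box: "cbox a b = (+) a ` cbox 0 (b - a)"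
        by (simp add: cbox_translation[symmetric])
      have "?h ` cbox a b = (+) (?h a) ` ?h ` cbox 0 (b - a)"
        unfolding box image_image using linear_add[OF lin] by simp
      then have "measure lebesgue (?h ` cbox a b) = measure lebesgue (?h ` cbox 0 (b - a))"
        by (simp only: measure_translation)
      also have "\<dots> = measure lebesgue (cbox 0 (b - a))"
        using False that by (intro measure_shear_interval) (auto simp: box)
      also have "\<dots> = measure lebesgue (cbox a b)"
        unfolding box by (simp only: measure_translation)
      finally show ?thesis by simp
    qed simp
    show ?thesis
      unfolding Q_def det_shear[OF that]
    proof (intro conjI ballI lin)
      fix S :: "(real^'n) set" assume S: "S \<in> lmeasurable"
      show "?h ` S \<in> lmeasurable" "measure lebesgue (?h ` S) = \<bar>1\<bar> * measure lebesgue S"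
        using measure_linear_sufficient[OF lin S box] by auto
    qed
  qed
  have "Q f"
  proof (rule induct_linear_elementary[OF \<open>linear f\<close>])
    \<comment> \<open>The image lies in a coordinate hyperplane, so both sides of the volume formula
      are 0.\<close>
    fix f :: "real^'n \<Rightarrow> real^'n" and i assume f: "linear f" "\<And>x. f x $ i = 0"
    then have "\<not> surj f"
      by (metis one_neq_zero surjE vec_component)
    then have inj: "\<not> inj f"
      using f(1) linear_injective_imp_surjective by blast
    then have "det (matrix f) = 0"
      using det_nz_iff_inj[OF f(1)] by blast
    moreover have "negligible (f ` S)" for S
      by (rule negligible_subset[OF negligible_linear_singular_image[OF f(1) inj]]) auto
    ultimately show "Q f"
      unfolding Q_def using f(1) by (auto simp: negligible_iff_measure)
  next
    fix m k :: 'n assume mk: "m \<noteq> k"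
    let ?s = "\<lambda>m k (x :: real^'n). \<chi> i. if i = m then x $ m + x $ k else x $ i"
    let ?d = "\<lambda>m (x :: real^'n). \<chi> i. (if i = m then -1 else 1) * x $ i"
    \<comment> \<open>(x, y) \<mapsto> (x + y, y) \<mapsto> (- x - y, y) \<mapsto> (- x - y, - x) \<mapsto> (x + y, - x) \<mapsto> (y, - x) \<mapsto> (y, x)\<close>
    have "(\<lambda>x. \<chi> i. x $ Transposition.transpose m k i)
        = ?d k \<circ> (?s m k \<circ> (?d m \<circ> (?s k m \<circ> (?d m \<circ> ?s m k))))"
      using mk by (auto simp: fun_eq_iff vec_eq_iff Transposition.transpose_def)
    then show "Q (\<lambda>x. \<chi> i. x $ Transposition.transpose m k i)"
      using comp[OF stretch comp[OF shear[OF mk] comp[OF stretch comp[OF shear[OF mk[symmetric]]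
        comp[OF stretch shear[OF mk]]]]],
          of "\<lambda>i. if i = k then -1 else 1" "\<lambda>i. if i = m then -1 else 1" "\<lambda>i. if i = m then -1 else 1"]
      by (simp only:)
  next
    show "Q f \<Longrightarrow> Q g \<Longrightarrow> Q (f \<circ> g)" for f g
      by (rule comp)
  qed (fact stretch shear)+
  then show ?thesis
    using assms(2) unfolding Q_def by blast
qed

section \<open>Lattices and Voronoi cells\<close>

lemma lattice_point_add: "lattice_point G (j + k) = lattice_point G j + lattice_point G k"
  unfolding lattice_point_def
  by (subst matrix_vector_right_distrib[symmetric]) (simp add: vec_eq_iff plus_vec_def)

lemma lattice_point_diff: "lattice_point G (j - k) = lattice_point G j - lattice_point G k"
  using lattice_point_add[of G "j - k" k] by simp

lemma lattice_point_0 [simp]: "lattice_point G 0 = 0"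
  using lattice_point_diff[of G 0 0] by simp

lemma lattice_point_minus: "lattice_point G (- j) = - lattice_point G j"
  using lattice_point_diff[of G 0 j] by simp

lemma lattice_point_scaleR: "lattice_point (c *\<^sub>R G) j = c *\<^sub>R lattice_point G j"
  unfolding lattice_point_def by (rule scaleR_matrix_vector_assoc[symmetric])

lemma finite_int_vecs_bounded: "finite {j :: int^'n. \<forall>i. \<bar>j $ i\<bar> \<le> m}"
proof (rule finite_subset)
  show "{j :: int^'n. \<forall>i. \<bar>j $ i\<bar> \<le> m} \<subseteq> vec_lambda ` (UNIV \<rightarrow>\<^sub>E {-m..m})"
  proof
    fix j :: "int^'n" assume "j \<in> {j. \<forall>i. \<bar>j $ i\<bar> \<le> m}"
    then have "($) j \<in> UNIV \<rightarrow>\<^sub>E {-m..m}"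
      by (auto simp: abs_le_iff) (metis minus_le_iff)
    then show "j \<in> vec_lambda ` (UNIV \<rightarrow>\<^sub>E {-m..m})"
      by (intro image_eqI[of _ _ "($) j"]) auto
  qed
qed (intro finite_imageI finite_PiE; simp)

text \<open>An injective linear map is bounded below, so a bounded lattice point has bounded integer
  coordinates.\<close>

lemma finite_lattice_ball:
  fixes G :: "real^'n^'n"
  assumes "rank G = CARD('n)"
  shows "finite {j. norm (x - lattice_point G j) \<le> R}"
proof -
  obtain B where B: "B > 0" "\<And>v. B * norm v \<le> norm (G *v v)"
    using assms linear_inj_bounded_below_pos[of "(*v) G"] unfolding full_rank_injective by auto
  have "\<bar>j $ i\<bar> \<le> \<lceil>(R + norm x) / B\<rceil>" if "norm (x - lattice_point G j) \<le> R" for j i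
  proof -
    have "\<bar>real_of_int (j $ i)\<bar> \<le> norm (\<chi> i. real_of_int (j $ i))"
      using component_le_norm_cart[of "\<chi> i. real_of_int (j $ i)" i] by simp
    also have "\<dots> \<le> norm (lattice_point G j) / B"
      using B by (simp add: lattice_point_def field_simps)
    also have "\<dots> \<le> (R + norm x) / B"
    proof (intro divide_right_mono)
      show "norm (lattice_point G j) \<le> R + norm x"
        using that norm_triangle_ineq3[of x "lattice_point G j"] by linarith
    qed (use B in simp)
    finally show ?thesis
      by linarith
  qed
  then show ?thesis
    by (intro finite_subset[OF _ finite_int_vecs_bounded[of "\<lceil>(R + norm x) / B\<rceil>"]]) auto
qed

lemma packing_radius_le:
  assumes "j \<noteq> 0"
  shows "2 * packing_radius G \<le> norm (lattice_point G j)"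
  unfolding packing_radius_def using assms
  by (auto intro!: cINF_lower bdd_belowI[of _ 0])

lemma nonzero_int_vecs: "- {0 :: int^'n} \<noteq> {}"
proof -
  have "(1 :: int^'n) \<noteq> 0"
    by (simp add: vec_eq_iff)
  then show ?thesis
    by blast
qed

text \<open>A nonzero integer vector has norm at least 1, so the lower bound \<open>B\<close> of the
  map \<open>G\<close> also bounds the infimum.\<close>

lemma packing_radius_pos:
  fixes G :: "real^'n^'n"
  assumes "rank G = CARD('n)"
  shows "packing_radius G > 0"
proof -
  obtain B where B: "B > 0" "\<And>v. B * norm v \<le> norm (G *v v)"
    using assms linear_inj_bounded_below_pos[of "(*v) G"] unfolding full_rank_injective by auto
  have "B \<le> (INF j \<in> - {0}. norm (lattice_point G j))"
  proof (rule cINF_greatest)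
    show "- {0 :: int^'n} \<noteq> {}"
      by (rule nonzero_int_vecs)
    fix j :: "int^'n" assume "j \<in> - {0}"
    then obtain i where i: "j $ i \<noteq> 0"
      by (auto simp: vec_eq_iff)
    then have "1 \<le> \<bar>real_of_int (j $ i)\<bar>"
      by linarith
    also have "\<dots> \<le> norm (\<chi> i. real_of_int (j $ i))"
      using component_le_norm_cart[of "\<chi> i. real_of_int (j $ i)" i] by simp
    finally have "B * 1 \<le> B * norm (\<chi> i. real_of_int (j $ i))"
      using B(1) by (intro mult_left_mono) auto
    then show "B \<le> norm (lattice_point G j)"
      using B(2)[of "\<chi> i. real_of_int (j $ i)"] unfolding lattice_point_def by linarith
  qed
  then show ?thesis
    unfolding packing_radius_def using B(1) by linarith
qed

text \<open>The partition read pointwise: disjointness is uniqueness and covering is existence of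
  the index.\<close>

lemma basic_cell_iff:
  "basic_cell G P \<longleftrightarrow> bounded P \<and> (\<forall>x. \<exists>!j. x - lattice_point G j \<in> P)"
proof -
  have mem: "x \<in> (\<lambda>x. x + lattice_point G j) ` P \<longleftrightarrow> x - lattice_point G j \<in> P" for x j
    by (auto simp: image_iff intro: bexI[of _ "x - lattice_point G j"])
  show ?thesis
    unfolding basic_cell_def disjoint_family_on_def set_eq_iff Int_iff UN_iff mem by auto
qed

text \<open>Rounding down the coordinates of the preimage under \<open>G\<close> leaves a remainder
  in the unit cube, whose image is bounded. This makes the Voronoi cell bounded.\<close>

lemma exists_near_lattice_point:
  fixes G :: "real^'n^'n"
  assumes "rank G = CARD('n)"
  obtains D where "\<And>x. \<exists>j. norm (x - lattice_point G j) \<le> D"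
proof -
  obtain B where B: "\<And>v. norm (G *v v) \<le> norm v * B"
    using bounded_linear.bounded[OF matrix_vector_mul_bounded_linear[of G]] by auto
  have "surj ((*v) G)"
    using assms linear_injective_imp_surjective[of "(*v) G"] unfolding full_rank_injective by simp
  have "\<exists>j. norm (x - lattice_point G j) \<le> real CARD('n) * \<bar>B\<bar>" for x
  proof -
    obtain v where v: "x = G *v v"
      using \<open>surj ((*v) G)\<close> by (metis surjD)
    define j where "j = (\<chi> i. \<lfloor>v $ i\<rfloor>)"
    let ?w = "v - (\<chi> i. real_of_int (j $ i))"
    have "norm ?w \<le> (\<Sum>i\<in>UNIV. \<bar>?w $ i\<bar>)"
      by (rule norm_le_l1_cart)
    also have "\<dots> \<le> (\<Sum>i\<in>(UNIV :: 'n set). 1)"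
      by (intro sum_mono) (auto simp: j_def abs_le_iff, linarith+)
    finally have w: "norm ?w \<le> real CARD('n)"
      by simp
    have "norm (x - lattice_point G j) = norm (G *v ?w)"
      by (simp add: v lattice_point_def matrix_vector_mult_diff_distrib)
    also have "\<dots> \<le> norm ?w * B"
      by (rule B)
    also have "\<dots> \<le> norm ?w * \<bar>B\<bar>"
      by (intro mult_left_mono) auto
    also have "\<dots> \<le> real CARD('n) * \<bar>B\<bar>"
      using w by (intro mult_right_mono) auto
    finally show ?thesis by blast
  qed
  then show thesis
    using that by blast
qed

lemma less_fun_shift:
  fixes j k l :: "int^'n::{finite,linorder}"
  shows "less_fun (($) (j + l)) (($) (k + l)) \<longleftrightarrow> less_fun (($) j) (($) k)"
  by (simp add: less_fun_def)

text \<open>Distances and the lexicographic order are both invariant under lattice translations, so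
  the points with nearest index \<open>j\<close> form the Voronoi cell shifted by
  \<open>lattice_point G j\<close>.\<close>

lemma nearest_index_shift:
  "nearest_index G x j \<longleftrightarrow> nearest_index G (x - lattice_point G j) 0"
proof -
  let ?p = "lattice_point G"
  have "(\<forall>k. k \<noteq> j \<longrightarrow> R k) \<longleftrightarrow> (\<forall>k. k \<noteq> 0 \<longrightarrow> R (k + j))" for R
    by (metis add.left_neutral add_right_cancel diff_add_cancel)
  then show ?thesis
    unfolding nearest_index_def
    using less_fun_shift[of 0 j]
    by (simp add: lattice_point_add algebra_simps)
qed

lemma ex1_nearest_index:
  fixes G :: "real^'n::{finite,linorder}^'n::{finite,linorder}"
  assumes "rank G = CARD('n)"
  shows "\<exists>!j. nearest_index G x j"
proof -
  let ?d = "\<lambda>j. norm (x - lattice_point G j)"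
  define R where "R j k \<longleftrightarrow> ?d j < ?d k \<or> ?d j = ?d k \<and> less_fun (($) j) (($) k)" for j k
  have total: "R j k \<or> R k j" if "j \<noteq> k" for j k
  proof -
    have "($) j \<noteq> ($) k"
      using that by (metis vec_nth_inject)
    then show ?thesis
      using less_fun_trichotomy[of "($) j" "($) k"] unfolding R_def by fastforce
  qed
  have asym: "\<not> R k j" if "R j k" for j k
    using that less_fun_asym[of "($) j" "($) k"] unfolding R_def by auto
  have trans: "R j l" if "R j k" "R k l" for j k l
    using that less_fun_trans[of "($) j" "($) k" "($) l"] unfolding R_def by auto
  \<comment> \<open>A finite set of candidates that contains index 0. Every index outside is
    strictly farther than those inside, so a minimum over \<open>?J\<close> is global.\<close>
  let ?J = "{j. ?d j \<le> norm x}"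
  have "\<exists>m\<in>?J. \<forall>k\<in>?J. k \<noteq> m \<longrightarrow> \<not> R k m"
  proof (rule Finite_Set.bex_min_element)
    show "finite ?J"
      by (rule finite_lattice_ball[OF assms])
    show "asymp_on ?J R"
      by (rule asymp_onI) (rule asym)
    show "transp_on ?J R"
      by (rule transp_onI) (rule trans)
    show "?J \<noteq> {}"
      by (auto intro: exI[of _ 0])
  qed
  then obtain m where m: "m \<in> ?J" "\<And>k. k \<in> ?J \<Longrightarrow> k \<noteq> m \<Longrightarrow> \<not> R k m"
    by blast
  have "R m k" if "k \<noteq> m" for k
  proof (cases "k \<in> ?J")
    case True
    then show ?thesis using m(2) total that by blast
  next
    case False
    then show ?thesis using m(1) unfolding R_def by simp
  qed
  then have "nearest_index G x m"
    unfolding nearest_index_def R_def by blast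
  moreover have "j = m" if "nearest_index G x j" for j
    using that \<open>nearest_index G x m\<close> asym[of j m] unfolding nearest_index_def R_def by metis
  ultimately show ?thesis by blast
qed

lemma basic_cell_voronoi:
  fixes G :: "real^'n::{finite,linorder}^'n::{finite,linorder}"
  assumes "rank G = CARD('n)"
  shows "basic_cell G (voronoi_cell G)"
proof -
  obtain D where D: "\<And>x. \<exists>j. norm (x - lattice_point G j) \<le> D"
    using exists_near_lattice_point[OF assms] by blast
  have "norm x \<le> D" if "x \<in> voronoi_cell G" for x
  proof -
    obtain j where "norm (x - lattice_point G j) \<le> D"
      using D by blast
    then show ?thesis
      using that unfolding voronoi_cell_def nearest_index_def by (cases "j = 0") force+
  qed
  then have "bounded (voronoi_cell G)"
    by (auto simp: bounded_iff)
  then show ?thesis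
    unfolding basic_cell_iff voronoi_cell_def
    using ex1_nearest_index[OF assms] by (simp flip: nearest_index_shift)
qed

text \<open>In the open ball 0 is strictly nearest, so ties do not arise.\<close>

lemma ball_subset_voronoi:
  fixes G :: "real^'n::{finite,linorder}^'n::{finite,linorder}"
  assumes "\<And>j. j \<noteq> 0 \<Longrightarrow> 2 * r \<le> norm (lattice_point G j)"
  shows "ball 0 r \<subseteq> voronoi_cell G"
proof
  fix x :: "real^'n::{finite,linorder}" assume x: "x \<in> ball 0 r"
  have "norm x < norm (x - lattice_point G j)" if "j \<noteq> 0" for j
    using assms[OF that] x norm_triangle_ineq3[of "lattice_point G j" x]
    by (simp add: norm_minus_commute)
  then show "x \<in> voronoi_cell G"
    unfolding voronoi_cell_def nearest_index_def by simp
qed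

lemma borel_voronoi: "voronoi_cell G \<in> sets borel"
proof -
  have "voronoi_cell G = (\<Inter>k\<in>-{0}. {x. norm x < norm (x - lattice_point G k)} \<union>
      (if less_fun (($) 0) (($) k) then {x. norm x = norm (x - lattice_point G k)} else {}))"
    unfolding voronoi_cell_def nearest_index_def by (auto split: if_splits)
  moreover have "{x. norm x < norm (x - lattice_point G k)} \<in> sets borel"
      "{x. norm x = norm (x - lattice_point G k)} \<in> sets borel" for k
    by (auto intro!: borel_open open_Collect_less borel_closed closed_Collect_eq continuous_intros)
  ultimately show ?thesis
    by (simp only:) (intro sets.countable_INT' nonzero_int_vecs; auto)
qed

section \<open>Tilings and the volume of a basic cell\<close>

lemma emeasure_lborel_translate:
  fixes S :: "'a::euclidean_space set"
  assumes [measurable]: "S \<in> sets borel"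
  shows "emeasure lborel {x. x + c \<in> S} = emeasure lborel S"
proof -
  have "emeasure lborel S = emeasure (distr lborel borel ((+) c)) S"
    by (simp add: lborel_distr_plus)
  also have "\<dots> = emeasure lborel {x. x + c \<in> S}"
    by (subst emeasure_distr) (auto simp: vimage_def add.commute)
  finally show ?thesis ..
qed

locale lattice_cell =
  fixes G :: "real^'n^'n" and P :: "(real^'n) set"
  assumes rank: "rank G = CARD('n)" and cell: "basic_cell G P" and borel_P [measurable]: "P \<in> sets borel"
begin

lemma ex1_cell: "\<exists>!j. x - lattice_point G j \<in> P"
  using cell by (simp add: basic_cell_iff)

text \<open>The offset \<open>a\<close> serves two uses: \<open>a = 0\<close> to compare two cells,
  and \<open>a = - x\<close> for the error at input \<open>x\<close>.\<close>

lemma emeasure_tiling: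
  assumes [measurable]: "B \<in> sets borel"
  shows "(\<integral>\<^sup>+j. emeasure lborel {x \<in> B. x - a - lattice_point G j \<in> P} \<partial>count_space UNIV) = emeasure lborel B"
proof -
  have "(\<integral>\<^sup>+j. emeasure lborel {x \<in> B. x - a - lattice_point G j \<in> P} \<partial>count_space UNIV)
      = emeasure lborel (\<Union>j. {x \<in> B. x - a - lattice_point G j \<in> P})"
  proof (rule emeasure_UN_countable[symmetric])
    show "disjoint_family (\<lambda>j. {x \<in> B. x - a - lattice_point G j \<in> P})"
      using ex1_cell by (auto simp: disjoint_family_on_def)
  qed auto
  also have "(\<Union>j. {x \<in> B. x - a - lattice_point G j \<in> P}) = B"
    using ex1_cell by blast
  finally show ?thesis .
qed

lemma bounded_cell: "bounded P"
  using cell by (simp add: basic_cell_iff)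

lemma emeasure_cell_finite: "emeasure lborel P < \<infinity>"
  using bounded_cell by (rule emeasure_bounded_finite)

end

text \<open>Cut \<open>P\<close> by the translates of \<open>F\<close>. The piece with index
  \<open>j\<close>, moved by minus the lattice point of \<open>j\<close>, is the piece of
  \<open>F\<close> cut out by the translate of \<open>P\<close> with index
  \<open>- j\<close>.\<close>

lemma emeasure_cells_eq:
  assumes "lattice_cell G P" "lattice_cell G F"
  shows "emeasure lborel P = emeasure lborel F"
proof -
  interpret P: lattice_cell G P by fact
  interpret F: lattice_cell G F by fact
  let ?p = "lattice_point G"
  have "emeasure lborel P = (\<integral>\<^sup>+j. emeasure lborel {x \<in> P. x - 0 - ?p j \<in> F} \<partial>count_space UNIV)"
    by (rule F.emeasure_tiling[symmetric]) simp
  also have "\<dots> = (\<integral>\<^sup>+j. emeasure lborel {x \<in> F. x - 0 - ?p (- j) \<in> P} \<partial>count_space UNIV)"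
  proof (rule nn_integral_cong)
    fix j
    have "{x \<in> P. x - 0 - ?p j \<in> F} = {x. x + (- ?p j) \<in> {x \<in> F. x - 0 - ?p (- j) \<in> P}}"
      by (auto simp: lattice_point_minus)
    then show "emeasure lborel {x \<in> P. x - 0 - ?p j \<in> F} = emeasure lborel {x \<in> F. x - 0 - ?p (- j) \<in> P}"
      by (simp only:) (rule emeasure_lborel_translate, measurable)
  qed
  also have "\<dots> = (\<integral>\<^sup>+j. emeasure lborel {x \<in> F. x - 0 - ?p j \<in> P} \<partial>count_space UNIV)"
    by (rule nn_integral_bij_count_space[where g = uminus and f = "\<lambda>j. emeasure lborel {x \<in> F. x - 0 - ?p j \<in> P}"])
       (rule bij_uminus)
  also have "\<dots> = emeasure lborel F"
    by (rule P.emeasure_tiling) simp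
  finally show ?thesis .
qed

lemma emeasure_unit_cube: "emeasure lborel {x :: real^'n. \<forall>i. 0 \<le> x $ i \<and> x $ i < 1} = 1"
proof -
  let ?C = "{x :: real^'n. \<forall>i. 0 \<le> x $ i \<and> x $ i < 1}"
  have [measurable]: "?C \<in> sets borel"
    by measurable
  have "emeasure lborel (box 0 1 :: (real^'n) set) \<le> emeasure lborel ?C"
    by (rule emeasure_mono) (auto simp: mem_box_cart less_imp_le)
  moreover have "emeasure lborel ?C \<le> emeasure lborel (cbox 0 1 :: (real^'n) set)"
    by (rule emeasure_mono) (auto simp: mem_box_cart less_imp_le)
  moreover have "emeasure lborel (cbox 0 1 :: (real^'n) set) = 1"
  proof -
    have "measure lborel (cbox 0 1 :: (real^'n) set) = 1"
      by (subst content_cbox_cart) (auto simp: interval_ne_empty_cart)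
    then show ?thesis
      using emeasure_lborel_cbox_finite[of "0 :: real^'n" 1] by (subst emeasure_eq_ennreal_measure) auto
  qed
  moreover have "emeasure lborel (box 0 1 :: (real^'n) set) = emeasure lborel (cbox 0 1 :: (real^'n) set)"
    unfolding emeasure_lborel_cbox_eq emeasure_lborel_box_eq ..
  ultimately show ?thesis
    by simp
qed

text \<open>The reference cell is the image of the half-open unit cube under \<open>G\<close>; the
  integer parts of coordinates make the cube a cell of the integer lattice.\<close>

lemma (in lattice_cell) emeasure_cell: "emeasure lborel P = ennreal \<bar>det G\<bar>"
proof -
  let ?C = "{x :: real^'n. \<forall>i. 0 \<le> x $ i \<and> x $ i < 1}"
  let ?F = "(*v) G ` ?C"
  have inj: "inj ((*v) G)"
    using rank by (simp add: full_rank_injective)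
  then have surj: "surj ((*v) G)"
    using linear_injective_imp_surjective[of "(*v) G"] by simp
  obtain h where h: "linear h" "h \<circ> (*v) G = id" "(*v) G \<circ> h = id"
    using linear_injective_isomorphism[of "(*v) G"] inj by (auto simp: fun_eq_iff)
  \<comment> \<open>Through the inverse \<open>h\<close> the image becomes a preimage, which gives
    Borel measurability.\<close>
  have F_eq: "?F = {y. \<forall>i. 0 \<le> h y $ i \<and> h y $ i < 1}"
    using h(2,3) by (auto simp: fun_eq_iff image_iff) metis
  have "h \<in> borel_measurable borel"
    by (intro borel_measurable_continuous_onI linear_continuous_on) (simp add: linear_conv_bounded_linear[symmetric] h)
  then have borel_F: "?F \<in> sets borel"
    unfolding F_eq by measurable
  have cube: "\<exists>!j. x - (\<chi> i. real_of_int (j $ i)) \<in> ?C" for x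
  proof (rule ex1I)
    show "x - (\<chi> i. real_of_int ((\<chi> i. \<lfloor>x $ i\<rfloor>) $ i)) \<in> ?C"
      by (auto simp: le_floor_iff) linarith
    show "j = (\<chi> i. \<lfloor>x $ i\<rfloor>)" if "x - (\<chi> i. real_of_int (j $ i)) \<in> ?C" for j
      using that by (auto simp: vec_eq_iff intro!: floor_unique[symmetric]) (metis diff_less_eq add.commute)
  qed
  have "\<exists>!j. x - lattice_point G j \<in> ?F" for x
  proof -
    obtain v where v: "x = G *v v"
      using surj by (metis surjD)
    have "x - lattice_point G j \<in> ?F \<longleftrightarrow> v - (\<chi> i. real_of_int (j $ i)) \<in> ?C" for j
      unfolding v lattice_point_def matrix_vector_mult_diff_distrib[symmetric] inj_image_mem_iff[OF inj] ..
    then show ?thesis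
      using cube[of v] by simp
  qed
  moreover have "bounded ?C"
    by (rule bounded_subset[OF bounded_cbox[of 0 1]]) (auto simp: mem_box_cart less_imp_le)
  then have "bounded ?F"
    by (intro bounded_linear_image matrix_vector_mul_bounded_linear)
  ultimately have "lattice_cell G ?F"
    using rank borel_F by unfold_locales (auto simp: basic_cell_iff)
  then have "emeasure lborel P = emeasure lborel ?F"
    by (rule emeasure_cells_eq[OF lattice_cell_axioms])
  also have "emeasure lborel ?F = ennreal \<bar>det G\<bar>"
  proof -
    have meas: "?C \<in> sets borel"
      by measurable
    have "?C \<in> lmeasurable"
      by (rule bounded_set_imp_lmeasurable) (use \<open>bounded ?C\<close> meas in auto)
    then have "measure lebesgue ?F = \<bar>det (matrix ((*v) G))\<bar> * measure lebesgue ?C"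
      using measure_linear_image_cart[of "(*v) G" ?C] by simp
    also have "\<dots> = \<bar>det G\<bar>"
      using emeasure_unit_cube[where 'n='n] meas by (simp add: matrix_of_matrix_vector_mul measure_completion measure_def)
    finally have "measure lborel ?F = \<bar>det G\<bar>"
      using borel_F by (simp add: measure_completion)
    then show ?thesis
      using emeasure_bounded_finite[OF \<open>bounded ?F\<close>] by (subst emeasure_eq_ennreal_measure) auto
  qed
  finally show ?thesis .
qed

section \<open>The error of a single proposal\<close>

context lattice_cell
begin

lemma cell_quantizer_eq_iff:
  "cell_quantizer G P x = y \<longleftrightarrow> y \<in> range (lattice_point G) \<and> y - x \<in> P"
proof -
  have mem: "x \<in> (\<lambda>p. - p + y) ` P \<longleftrightarrow> y - x \<in> P" for y
    by (auto simp: image_iff algebra_simps intro: bexI[of _ "y - x"])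
  \<comment> \<open>\<open>cell_quantizer\<close> uses the reflected cell, so the partition is
    applied at \<open>- x\<close> and the index changes sign.\<close>
  obtain j where j: "- x - lattice_point G j \<in> P" "\<And>k. - x - lattice_point G k \<in> P \<Longrightarrow> k = j"
    using ex1_cell[of "- x"] by blast
  have uniq: "y = - lattice_point G j" if "y \<in> range (lattice_point G)" "y - x \<in> P" for y
  proof -
    obtain k where "y = lattice_point G k"
      using \<open>y \<in> range _\<close> by blast
    with that(2) show ?thesis
      using j(2)[of "- k"] by (simp add: lattice_point_minus algebra_simps) (metis add.inverse_inverse lattice_point_minus)
  qed
  have mem_j: "- lattice_point G j - x \<in> P"
    using j(1) by (metis minus_diff_commute)
  have range_j: "- lattice_point G j \<in> range (lattice_point G)"
    by (metis lattice_point_minus rangeI)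
  have ex1: "\<exists>!y. y \<in> range (lattice_point G) \<and> y - x \<in> P"
    by (rule ex1I, rule conjI[OF range_j mem_j]) (elim conjE, rule uniq)
  show ?thesis
    unfolding cell_quantizer_def mem
  proof
    assume "(THE y. y \<in> range (lattice_point G) \<and> y - x \<in> P) = y"
    then show "y \<in> range (lattice_point G) \<and> y - x \<in> P"
      using theI'[OF ex1] by simp
  qed (rule the1_equality[OF ex1])
qed

lemma cell_quantizer_in:
  "cell_quantizer G P x \<in> range (lattice_point G)" "cell_quantizer G P x - x \<in> P"
  using cell_quantizer_eq_iff[of x "cell_quantizer G P x"] by auto

lemma measurable_cell_quantizer [measurable]: "cell_quantizer G P \<in> borel_measurable borel"
proof (rule measurableI)
  fix B :: "(real^'n) set" assume "B \<in> sets borel"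
  have "cell_quantizer G P -` B \<inter> space borel = (\<Union>y\<in>B \<inter> range (lattice_point G). {x. y - x \<in> P})"
  proof -
    have "cell_quantizer G P x \<in> B \<longleftrightarrow> (\<exists>y\<in>B \<inter> range (lattice_point G). y - x \<in> P)" for x
      using cell_quantizer_in[of x] cell_quantizer_eq_iff[of x] by (metis IntD1 IntD2 IntI)
    then show ?thesis
      by auto
  qed
  also have "\<dots> \<in> sets borel"
    by (intro sets.countable_UN') (auto intro: countable_subset[OF Int_lower2])
  finally show "cell_quantizer G P -` B \<inter> space borel \<in> sets borel" .
qed auto

text \<open>The representative of \<open>v - x\<close> in \<open>P\<close> modulo the lattice, as
  \<open>err_eq_iff\<close> makes precise.\<close>

definition "err x v = cell_quantizer G P (x - v) + v - x"

lemma measurable_err [measurable]: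
  assumes [measurable]: "f \<in> borel_measurable M" "g \<in> borel_measurable M"
  shows "(\<lambda>w. err (f w) (g w)) \<in> borel_measurable M"
  unfolding err_def by measurable

lemma err_eq_iff: "err x v = e \<longleftrightarrow> e \<in> P \<and> (\<exists>j. e = v - x + lattice_point G j)"
proof -
  have 1: "err x v = e \<longleftrightarrow> cell_quantizer G P (x - v) = e - v + x"
    unfolding err_def by (auto simp: algebra_simps)
  have "e - v + x = lattice_point G j \<longleftrightarrow> e = v - x + lattice_point G j" for j
    by (auto simp: algebra_simps)
  then have 2: "e - v + x \<in> range (lattice_point G) \<longleftrightarrow> (\<exists>j. e = v - x + lattice_point G j)"
    by (simp only: image_iff) blast
  have 3: "e - v + x - (x - v) = e"
    by simp
  show ?thesis
    unfolding 1 cell_quantizer_eq_iff 2 3 by (rule conj_commute)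
qed

text \<open>For fixed \<open>x\<close>, reduction modulo the lattice moves pieces of
  \<open>P\<close> by translations, and the images tile \<open>P\<close> again; hence it preserves
  volume.\<close>

lemma emeasure_err:
  assumes [measurable]: "S \<in> sets borel"
  shows "emeasure lborel {v \<in> P. err x v \<in> S} = emeasure lborel (P \<inter> S)"
proof -
  let ?p = "lattice_point G"
  let ?X = "\<lambda>j. {v \<in> P. v - x + ?p j \<in> P \<inter> S}"
  have "err x v \<in> S \<longleftrightarrow> (\<exists>j. v - x + ?p j \<in> P \<inter> S)" for v
  proof
    assume "err x v \<in> S"
    moreover obtain j where "err x v = v - x + ?p j" "err x v \<in> P"
      using err_eq_iff[of x v "err x v"] by auto
    ultimately show "\<exists>j. v - x + ?p j \<in> P \<inter> S"
      by (intro exI[of _ j]) simp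
  next
    assume "\<exists>j. v - x + ?p j \<in> P \<inter> S"
    then obtain j where j: "v - x + ?p j \<in> P" "v - x + ?p j \<in> S"
      by auto
    then have "err x v = v - x + ?p j"
      unfolding err_eq_iff by auto
    then show "err x v \<in> S"
      using j by simp
  qed
  then have "{v \<in> P. err x v \<in> S} = (\<Union>j. ?X j)"
    by auto
  also have "emeasure lborel (\<Union>j. ?X j) = (\<integral>\<^sup>+j. emeasure lborel (?X j) \<partial>count_space UNIV)"
  proof (rule emeasure_UN_countable)
    have "j = k" if "v - x + ?p j \<in> P" "v - x + ?p k \<in> P" for v j k
      using that ex1_cell[of "v - x"] by (metis add.inverse_inverse diff_minus_eq_add lattice_point_minus)
    then show "disjoint_family ?X"
      by (fastforce simp: disjoint_family_on_def)
  qed auto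
  also have "\<dots> = (\<integral>\<^sup>+j. emeasure lborel {w \<in> P \<inter> S. w - (- x) - ?p j \<in> P} \<partial>count_space UNIV)"
  proof (rule nn_integral_cong)
    fix j
    have "?X j = {v. v + (?p j - x) \<in> {w \<in> P \<inter> S. w - (- x) - ?p j \<in> P}}"
      by (auto simp: algebra_simps)
    then show "emeasure lborel (?X j) = emeasure lborel {w \<in> P \<inter> S. w - (- x) - ?p j \<in> P}"
      by (simp only:) (rule emeasure_lborel_translate, measurable)
  qed
  also have "\<dots> = emeasure lborel (P \<inter> S)"
    by (rule emeasure_tiling) simp
  finally show ?thesis .
qed

end

section \<open>The rejection-sampled quantizer\<close>

context lattice_cell
begin

lemma err_exists: "\<exists>j. err x v = v - x + lattice_point G j"
  using err_eq_iff by blast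

lemma rsuq_accepts_iff: "rsuq_accepts G P A x v \<longleftrightarrow> err x v \<in> A"
  by (simp add: rsuq_accepts_def err_def)

lemma rsuq_map_eq: "rsuq_map G P A x v = err x (v (first_hit {w. err x w \<in> A} v)) + x"
  by (simp add: rsuq_map_def Let_def rsuq_accepts_iff first_hit_def err_def)

end

locale rsuq_cell = lattice_cell G P for G :: "real^'n^'n" and P +
  fixes A :: "(real^'n) set"
  assumes borel_A [measurable]: "A \<in> sets borel"
    and A_null: "A - P \<in> null_sets lborel"
    and A_pos: "measure lborel A > 0"
begin

abbreviation "U \<equiv> uniform_measure lborel P"

definition "accept_prob = measure lborel A / measure lborel P"

lemma emeasure_A: "emeasure lborel (P \<inter> S \<inter> A) = emeasure lborel (S \<inter> A)" if [measurable]: "S \<in> sets borel"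
  by (rule emeasure_eq_AE) (use AE_not_in[OF A_null] in \<open>auto elim: eventually_mono\<close>)

lemma emeasure_cell_real: "emeasure lborel P = ennreal (measure lborel P)"
  using emeasure_cell_finite by (simp add: emeasure_eq_ennreal_measure)

lemma emeasure_A_real: "emeasure lborel A = ennreal (measure lborel A)"
  \<comment> \<open>\<open>measure\<close> is 0 on sets of infinite measure, so a positive value
    implies finiteness.\<close>
  using A_pos by (intro emeasure_eq_ennreal_measure) (auto simp: measure_def)

lemma measure_A_le: "measure lborel A \<le> measure lborel P"
proof -
  have "emeasure lborel A = emeasure lborel (P \<inter> A)"
    using emeasure_A[of UNIV] by simp
  also have "\<dots> \<le> emeasure lborel P"
    by (rule emeasure_mono) auto
  finally show ?thesis
    unfolding emeasure_cell_real emeasure_A_real by simp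
qed

lemma measure_P_pos: "measure lborel P > 0"
  using measure_A_le A_pos by linarith

lemma prob_space_U: "prob_space U"
  using measure_P_pos by (intro prob_space_uniform_measure) (auto simp: emeasure_cell_real)

lemma accept_prob_bounds: "0 < accept_prob" "accept_prob \<le> 1"
  using A_pos measure_P_pos measure_A_le by (simp_all add: accept_prob_def)

lemma emeasure_U_err:
  assumes [measurable]: "S \<in> sets borel"
  shows "emeasure U {v. err x v \<in> S} = emeasure lborel (P \<inter> S) / emeasure lborel P"
  using emeasure_err[OF assms, of x] by (simp add: Collect_conj_eq)

lemma iid_err:
  assumes [measurable]: "S \<in> sets borel"
  shows "iid_sequence U {v. err x v \<in> S}"
proof -
  interpret prob_space U by (rule prob_space_U)
  show ?thesis
    by unfold_locales simp
qed

lemma measure_U_err: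
  assumes [measurable]: "S \<in> sets borel"
  shows "measure U {v. err x v \<in> S} = measure lborel (P \<inter> S) / measure lborel P"
proof -
  have "emeasure lborel (P \<inter> S) \<le> emeasure lborel P"
    by (rule emeasure_mono) auto
  then have "emeasure lborel (P \<inter> S) = ennreal (measure lborel (P \<inter> S))"
    using emeasure_cell_finite by (intro emeasure_eq_ennreal_measure) auto
  then have "emeasure U {v. err x v \<in> S} = ennreal (measure lborel (P \<inter> S) / measure lborel P)"
    unfolding emeasure_U_err[OF assms] using measure_P_pos by (simp add: emeasure_cell_real divide_ennreal)
  then show ?thesis
    by (simp add: measure_def)
qed

lemma measure_P_A: "measure lborel (P \<inter> A) = measure lborel A"
  using emeasure_A[of UNIV] by (simp add: measure_def)

lemma measure_U_err_A: "measure U {v. err x v \<in> A} = accept_prob"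
  by (simp add: measure_U_err measure_P_A accept_prob_def)

lemma rsuq_law_eq: "rsuq_law P = (\<Pi>\<^sub>M i\<in>UNIV. U)"
  by (simp add: rsuq_law_def)

lemma prob_space_rsuq_law: "prob_space (rsuq_law P)"
  unfolding rsuq_law_eq by (rule prob_space_PiM) (rule prob_space_U)

lemma space_rsuq_law [simp]: "space (rsuq_law P) = UNIV"
  by (simp add: rsuq_law_eq space_PiM)

lemma measurable_seed [measurable]: "(\<lambda>v. v i) \<in> borel_measurable (rsuq_law P)"
proof -
  have "(\<lambda>v. v i) \<in> measurable (\<Pi>\<^sub>M i\<in>UNIV. U) U"
    by (rule measurable_component_singleton) simp
  also have "measurable (\<Pi>\<^sub>M i\<in>UNIV. U) U = borel_measurable (\<Pi>\<^sub>M i\<in>UNIV. U)"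
    by (rule measurable_cong_sets) simp_all
  finally show ?thesis
    by (simp add: rsuq_law_eq)
qed

lemma measurable_first_hit_pair [measurable]:
  "(\<lambda>(x, v). first_hit {w. err x w \<in> A} v) \<in> measurable (borel \<Otimes>\<^sub>M rsuq_law P) (count_space UNIV)"
  unfolding first_hit_def by measurable

lemma measurable_rsuq_map:
  "(\<lambda>(x, v). rsuq_map G P A x v) \<in> borel_measurable (borel \<Otimes>\<^sub>M rsuq_law P)"
proof -
  have "(\<lambda>z. snd z (first_hit {w. err (fst z) w \<in> A} (snd z))) \<in> borel_measurable (borel \<Otimes>\<^sub>M rsuq_law P)"
    by (rule measurable_compose_countable[where f = "\<lambda>i z. snd z i"])
       (use measurable_first_hit_pair in \<open>auto simp: case_prod_unfold\<close>)
  then show ?thesis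
    unfolding rsuq_map_eq case_prod_unfold by measurable
qed

text \<open>Every output is some \<open>s k\<close> plus a lattice point, so an index and an integer
  vector determine it.\<close>

lemma countable_range_rsuq_map: "countable (range (\<lambda>x. rsuq_map G P A x s))"
proof (rule countable_subset)
  show "range (\<lambda>x. rsuq_map G P A x s) \<subseteq> (\<lambda>(k, j). s k + lattice_point G j) ` UNIV"
  proof safe
    fix x
    obtain j where "err x (s (first_hit {w. err x w \<in> A} s)) = s (first_hit {w. err x w \<in> A} s) - x + lattice_point G j"
      using err_exists by blast
    then show "rsuq_map G P A x s \<in> (\<lambda>(k, j). s k + lattice_point G j) ` UNIV"
      by (intro image_eqI[of _ _ "(first_hit {w. err x w \<in> A} s, j)"]) (auto simp: rsuq_map_eq)
  qed
qed auto

text \<open>The accepted sample is uniform on the acceptance set inside \<open>P\<close>, and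
  \<open>err x\<close> carries that law to the uniform law on \<open>A\<close> because it preserves
  volume.\<close>

lemma distr_rsuq_err:
  "distr (rsuq_law P) borel (\<lambda>s. rsuq_map G P A x s - x) = uniform_measure lborel A"
proof -
  interpret iid_sequence U "{v. err x v \<in> A}"
    by (rule iid_err) simp
  have err_meas [measurable]: "err x \<in> borel_measurable U'" if "sets U' = sets borel" for U'
  proof -
    have eq: "measurable U' borel = (borel_measurable borel :: (real^'n \<Rightarrow> real^'n) set)"
      by (rule measurable_cong_sets[OF that refl])
    show ?thesis
      unfolding eq by (rule measurable_err) simp_all
  qed
  have pos: "measure U {v. err x v \<in> A} > 0"
    using accept_prob_bounds by (simp add: measure_U_err_A)
  have "distr (rsuq_law P) borel (\<lambda>s. rsuq_map G P A x s - x)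
      = distr (distr seqs U (\<lambda>v. v (first_hit {v. err x v \<in> A} v))) borel (err x)"
    unfolding rsuq_law_eq rsuq_map_eq by (subst distr_distr) (auto simp: o_def err_meas intro: measurable_at_first_hit)
  also have "\<dots> = distr (uniform_measure U {v. err x v \<in> A}) borel (err x)"
    by (subst distr_at_first_hit[OF pos]) simp
  also have "\<dots> = uniform_measure lborel A"
  proof (rule measure_eqI)
    fix B assume "B \<in> sets (distr (uniform_measure U {v. err x v \<in> A}) borel (err x))"
    then have B [measurable]: "B \<in> sets borel" by simp
    have vB: "err x -` B \<in> sets U"
      using measurable_sets[OF err_meas[of borel] B] by simp
    have "emeasure (distr (uniform_measure U {v. err x v \<in> A}) borel (err x)) B
        = emeasure U ({v. err x v \<in> A} \<inter> err x -` B) / emeasure U {v. err x v \<in> A}"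
      using emeasure_uniform_measure[OF E vB] by (subst emeasure_distr) (simp_all add: err_meas)
    also have "{v. err x v \<in> A} \<inter> err x -` B = {v. err x v \<in> B \<inter> A}"
      by auto
    also have "emeasure U {v. err x v \<in> B \<inter> A} = emeasure lborel (B \<inter> A) / emeasure lborel P"
      using emeasure_A[OF B] by (subst emeasure_U_err) (auto simp: Int_assoc)
    also have "emeasure U {v. err x v \<in> A} = emeasure lborel A / emeasure lborel P"
      using emeasure_A[of UNIV] by (subst emeasure_U_err) auto
    also have "emeasure lborel (B \<inter> A) / emeasure lborel P / (emeasure lborel A / emeasure lborel P)
       = emeasure lborel (B \<inter> A) / emeasure lborel A"
    proof -
      have "emeasure lborel (B \<inter> A) \<le> emeasure lborel A"
        by (rule emeasure_mono) auto
      also have "\<dots> < \<infinity>"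
        by (simp add: emeasure_A_real)
      finally have "emeasure lborel (B \<inter> A) = ennreal (measure lborel (B \<inter> A))"
        by (intro emeasure_eq_ennreal_measure) auto
      then show ?thesis
        using measure_P_pos A_pos by (simp add: emeasure_cell_real emeasure_A_real divide_ennreal)
    qed
    finally show "emeasure (distr (uniform_measure U {v. err x v \<in> A}) borel (err x)) B
        = emeasure (uniform_measure lborel A) B"
      by (simp add: Int_commute)
  qed simp
  finally show ?thesis .
qed

text \<open>Acceptance has to hold for uncountably many inputs at once: a seed that hits the half-sized
  ball for all inputs of a countable dense set hits the full ball for all inputs.\<close>

lemma AE_rsuq_seeds:
  assumes "e > 0" and eA: "ball 0 e \<subseteq> A" and eP: "ball 0 e \<subseteq> P"
  shows "AE s in rsuq_law P. s \<in> rsuq_seeds G P A"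
proof -
  interpret iid_sequence U "{v. err 0 v \<in> A}"
    by (rule iid_err) simp
  have "AE s in rsuq_law P. \<forall>i. s i \<in> P"
    unfolding AE_all_countable rsuq_law_eq
  proof
    fix i
    have "AE v in U. v \<in> P"
      by (rule AE_uniform_measureI) auto
    then show "AE s in seqs. s i \<in> P"
      by (rule PP.AE_component[OF UNIV_I])
  qed
  moreover obtain D :: "(real^'n) set" where D: "countable D" "\<And>X. open X \<Longrightarrow> X \<noteq> {} \<Longrightarrow> \<exists>d\<in>D. d \<in> X"
    using countable_dense_exists by blast
  have "AE s in rsuq_law P. \<forall>d\<in>D. \<exists>i. err d (s i) \<in> ball 0 (e / 2)"
    unfolding AE_ball_countable[OF D(1)] rsuq_law_eq
  proof
    fix d
    interpret I: iid_sequence U "{v. err d v \<in> ball 0 (e / 2)}"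
      by (rule iid_err) simp
    have "P \<inter> ball 0 (e / 2) = ball 0 (e / 2)"
      using eP \<open>e > 0\<close> by (auto simp: subset_iff)
    then have "measure U {v. err d v \<in> ball 0 (e / 2)} > 0"
      using measure_P_pos \<open>e > 0\<close> content_ball_pos[of "e / 2" "0 :: real^'n"]
      by (subst measure_U_err) auto
    from I.AE_hit[OF this] show "AE s in seqs. \<exists>i. err d (s i) \<in> ball 0 (e / 2)"
      by simp
  qed
  ultimately show ?thesis
  proof eventually_elim
    case (elim s)
    have "\<exists>i. err x (s i) \<in> A" for x
    proof -
      obtain d where d: "d \<in> D" "dist x d < e / 2"
        using D(2)[of "ball x (e / 2)"] \<open>e > 0\<close> by auto
      then obtain i where i: "norm (err d (s i)) < e / 2"
        using elim(2) by auto
      obtain j where j: "err d (s i) = s i - d + lattice_point G j"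
        using err_exists by blast
      \<comment> \<open>The lattice point that serves input \<open>d\<close> is kept for input
        \<open>x\<close>. The error moves by less than e / 2, so it stays in the ball inside
        \<open>P\<close> and is therefore the true error at \<open>x\<close>.\<close>
      let ?w = "s i - x + lattice_point G j"
      have weq: "?w = err d (s i) + (d - x)"
        by (simp add: j)
      have "norm ?w < e"
        unfolding weq using i d(2) norm_triangle_ineq[of "err d (s i)" "d - x"]
        by (simp add: dist_norm norm_minus_commute)
      then have w: "?w \<in> ball 0 e"
        by simp
      then have "err x (s i) = ?w"
        using eP unfolding err_eq_iff by blast
      then show ?thesis
        using w eA by (intro exI[of _ i]) auto
    qed
    then show ?case
      using elim(1) by (simp add: rsuq_seeds_def rsuq_accepts_iff)
  qed
qed

lemma rsuq_err_in:
  assumes "s \<in> rsuq_seeds G P A"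
  shows "rsuq_map G P A x s - x \<in> A"
  using assms first_hit_in[of s "{w. err x w \<in> A}"]
  by (auto simp: rsuq_map_eq rsuq_seeds_def rsuq_accepts_iff)

lemma max_error_rsuq:
  assumes "r > 0" and rA: "ball 0 r \<subseteq> A" "A \<subseteq> cball 0 r" and rP: "ball 0 r \<subseteq> P"
  shows "max_error (rsuq_seeds G P A) (rsuq_map G P A) = ereal r"
proof -
  interpret S: prob_space "rsuq_law P"
    by (rule prob_space_rsuq_law)
  let ?S = "rsuq_seeds G P A" and ?X = "max_error (rsuq_seeds G P A) (rsuq_map G P A)"
  have "?X \<le> ereal r"
    unfolding max_error_def using rsuq_err_in rA(2) by (auto simp: subset_iff intro!: SUP_least)
  \<comment> \<open>Without a seed the supremum would range over an empty set; a set of probability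
    one has a member.\<close>
  moreover have "\<exists>s. s \<in> ?S"
  proof (rule ccontr)
    assume "\<nexists>s. s \<in> ?S"
    then have "AE s in rsuq_law P. s \<notin> ?S"
      by simp
    with AE_rsuq_seeds[OF \<open>r > 0\<close> rA(1) rP] show False
      by (rule S.AE_contr)
  qed
  then obtain s where s: "s \<in> ?S" ..
  have ge: "ereal t \<le> ?X" if "0 \<le> t" "t < r" for t
  proof -
    \<comment> \<open>Any error \<open>e\<close> in the open ball is realized by the input
      \<open>s 0 - e\<close>: the first sample gives exactly \<open>e\<close> and is accepted at
      once.\<close>
    obtain e :: "real^'n" where e: "norm e = t"
      using vector_choose_size[OF \<open>0 \<le> t\<close>] by blast
    then have "e \<in> ball 0 r"
      using that by simp
    then have "err (s 0 - e) (s 0) = e"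
      using rP unfolding err_eq_iff by (auto intro: exI[of _ 0])
    moreover have "first_hit {w. err (s 0 - e) w \<in> A} s = 0"
      unfolding first_hit_def using \<open>e \<in> ball 0 r\<close> rA(1) calculation by (intro Least_eq_0) auto
    ultimately have "rsuq_map G P A (s 0 - e) s - (s 0 - e) = e"
      by (simp add: rsuq_map_eq)
    then show ?thesis
      unfolding max_error_def using s e
      by (intro SUP_upper2[of "(s 0 - e, s)"]) auto
  qed
  have "ereal r \<le> ?X"
  proof (rule ccontr)
    assume "\<not> ereal r \<le> ?X"
    then have "?X < ereal r"
      by simp
    then obtain t where t: "?X < ereal t" "ereal t < ereal r"
      using ereal_dense2 by blast
    have "ereal 0 \<le> ?X"
      using ge[of 0] \<open>r > 0\<close> by simp
    then have "0 \<le> t"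
      using t(1) by (metis ereal_less_eq(3) less_imp_le order_trans)
    then show False
      using ge[of t] t by auto
  qed
  ultimately show ?thesis
    by simp
qed

text \<open>Integrating over the seed first leaves a constant, as the error law is the same for
  every input.\<close>

lemma mse_rsuq:
  assumes "prob_space PX" "sets PX = sets borel"
  shows "(\<integral>z. (norm (rsuq_map G P A (fst z) (snd z) - fst z))\<^sup>2 \<partial>(PX \<Otimes>\<^sub>M rsuq_law P))
     = enn2real (\<integral>\<^sup>+e. ennreal ((norm e)\<^sup>2) \<partial>uniform_measure lborel A)"
proof -
  interpret X: prob_space PX by fact
  interpret S: prob_space "rsuq_law P"
    by (rule prob_space_rsuq_law)
  let ?f = "\<lambda>z. (norm (rsuq_map G P A (fst z) (snd z) - fst z))\<^sup>2"
  have [measurable]: "(\<lambda>z. rsuq_map G P A (fst z) (snd z)) \<in> borel_measurable (PX \<Otimes>\<^sub>M rsuq_law P)"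
    using measurable_rsuq_map
    by (simp add: case_prod_unfold measurable_cong_sets[OF sets_pair_measure_cong[OF assms(2) refl] refl])
  have [measurable]: "fst \<in> borel_measurable (PX \<Otimes>\<^sub>M rsuq_law P)"
    using measurable_fst[of PX "rsuq_law P"] by (simp add: measurable_cong_sets[OF refl assms(2)])
  have meas: "?f \<in> borel_measurable (PX \<Otimes>\<^sub>M rsuq_law P)"
    by measurable
  have "(\<integral>z. ?f z \<partial>(PX \<Otimes>\<^sub>M rsuq_law P)) = enn2real (\<integral>\<^sup>+z. ennreal (?f z) \<partial>(PX \<Otimes>\<^sub>M rsuq_law P))"
    using meas by (intro integral_eq_nn_integral) auto
  also have "(\<integral>\<^sup>+z. ennreal (?f z) \<partial>(PX \<Otimes>\<^sub>M rsuq_law P)) = (\<integral>\<^sup>+x. \<integral>\<^sup>+s. ennreal (?f (x, s)) \<partial>rsuq_law P \<partial>PX)"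
    using meas by (intro S.nn_integral_fst[symmetric]) measurable
  also have "\<dots> = (\<integral>\<^sup>+x. (\<integral>\<^sup>+e. ennreal ((norm e)\<^sup>2) \<partial>uniform_measure lborel A) \<partial>PX)"
  proof (rule nn_integral_cong)
    fix x
    have [measurable]: "(\<lambda>s. rsuq_map G P A x s) \<in> borel_measurable (rsuq_law P)"
      using measurable_Pair2[OF measurable_rsuq_map, of x] by simp
    show "(\<integral>\<^sup>+s. ennreal (?f (x, s)) \<partial>rsuq_law P) = (\<integral>\<^sup>+e. ennreal ((norm e)\<^sup>2) \<partial>uniform_measure lborel A)"
      unfolding distr_rsuq_err[of x, symmetric] by (subst nn_integral_distr) auto
  qed
  also have "\<dots> = (\<integral>\<^sup>+e. ennreal ((norm e)\<^sup>2) \<partial>uniform_measure lborel A)"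
    by (simp add: X.emeasure_space_1)
  finally show ?thesis .
qed

subsection \<open>Entropy\<close>

text \<open>The cells attached to these lattice points are disjoint, have equal volume and lie in
  the ball enlarged by \<open>D\<close>.\<close>

lemma card_lattice_ball_le:
  assumes D: "P \<subseteq> cball 0 D"
  shows "real (card {j. norm (lattice_point G j) \<le> R}) * measure lborel P
      \<le> measure lborel (cball (0 :: real^'n) (R + D))"
proof -
  let ?J = "{j. norm (lattice_point G j) \<le> R}"
  have fin: "finite ?J"
    using finite_lattice_ball[OF rank, of 0 R] by simp
  have "ennreal (real (card ?J) * measure lborel P) = (\<Sum>j\<in>?J. emeasure lborel {x. x + (- lattice_point G j) \<in> P})"
    unfolding emeasure_lborel_translate[OF borel_P]
    by (simp add: emeasure_cell_real ennreal_mult ennreal_of_nat_eq_real_of_nat)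
  also have "\<dots> = emeasure lborel (\<Union>j\<in>?J. {x. x + (- lattice_point G j) \<in> P})"
  proof (rule sum_emeasure)
    have "j = k" if "x - lattice_point G j \<in> P" "x - lattice_point G k \<in> P" for x j k
      using that ex1_cell[of x] by blast
    then show "disjoint_family_on (\<lambda>j. {x. x + (- lattice_point G j) \<in> P}) ?J"
      by (fastforce simp: disjoint_family_on_def)
  qed (use fin in auto)
  also have "\<dots> \<le> emeasure lborel (cball (0 :: real^'n) (R + D))"
  proof (rule emeasure_mono)
    show "(\<Union>j\<in>?J. {x. x + (- lattice_point G j) \<in> P}) \<subseteq> cball 0 (R + D)"
    proof safe
      fix x j assume j: "norm (lattice_point G j) \<le> R" and x: "x + (- lattice_point G j) \<in> P"
      have "norm (x + (- lattice_point G j)) \<le> D"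
        using x D by auto
      then show "x \<in> cball 0 (R + D)"
        using j norm_triangle_ineq[of "x + (- lattice_point G j)" "lattice_point G j"] by simp
    qed
  qed simp
  also have "\<dots> = ennreal (measure lborel (cball (0 :: real^'n) (R + D)))"
    using emeasure_lborel_cball_finite[of "0 :: real^'n" "R + D"] by (intro emeasure_eq_ennreal_measure) auto
  finally show ?thesis
    by simp
qed

text \<open>Gibbs' inequality with the code that takes the stopping index geometric of parameter
  \<open>\<theta>\<close> and the lattice point uniform among those that can occur for inputs in the ball.\<close>

lemma shannon_entropy_rsuq_le:
  assumes th: "0 < \<theta>" "\<theta> < 1" and s: "s \<in> rsuq_seeds G P A"
    and bnd: "A \<subseteq> cball 0 r" "P \<subseteq> cball 0 D" and pos: "\<tau> > 0"
  shows "shannon_entropy (uniform_measure lborel (cball 0 \<tau>)) (\<lambda>x. rsuq_map G P A x s)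
    \<le> (\<integral>\<^sup>+x. ennreal (log 2 (real (card {j. norm (lattice_point G j) \<le> \<tau> + r + D})) - log 2 \<theta>
          - real (first_hit {w. err x w \<in> A} s) * log 2 (1 - \<theta>)) \<partial>uniform_measure lborel (cball 0 \<tau>))"
proof -
  let ?M = "uniform_measure lborel (cball (0 :: real^'n) \<tau>)"
  let ?Q = "\<lambda>x. rsuq_map G P A x s"
  define J where "J = {j. norm (lattice_point G j) \<le> \<tau> + r + D}"
  define k where "k x = first_hit {w. err x w \<in> A} s" for x
  define q where "q = map_pmf (\<lambda>(k, j). s k + lattice_point G j) (pair_pmf (geometric_pmf \<theta>) (pmf_of_set J))"
  have fin: "finite J"
    unfolding J_def using finite_lattice_ball[OF rank, of 0] by simp
  have vol: "emeasure lborel (cball (0 :: real^'n) \<tau>) = ennreal (measure lborel (cball (0 :: real^'n) \<tau>))"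
    using emeasure_lborel_cball_finite[of "0 :: real^'n" \<tau>] by (intro emeasure_eq_ennreal_measure) auto
  have prob: "prob_space ?M"
    using pos by (intro prob_space_uniform_measure) (auto simp: vol content_cball_pos)
  have meas: "(\<lambda>x. rsuq_map G P A x s) \<in> borel_measurable borel"
    using measurable_Pair1[OF measurable_rsuq_map, of s] by simp
  have bound: "pmf q (?Q x) \<ge> (1 - \<theta>) ^ k x * \<theta> / real (card J) \<and> card J > 0" if x: "norm x \<le> \<tau>" for x
  proof -
    have "s (k x) \<in> P"
      using s by (simp add: rsuq_seeds_def)
    then have sk: "norm (s (k x)) \<le> D"
      using bnd(2) by auto
    have e: "norm (?Q x - x) \<le> r"
      using rsuq_err_in[OF s, of x] bnd(1) by auto
    obtain j where j: "?Q x = s (k x) + lattice_point G j"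
      using err_exists[of x "s (k x)"] by (auto simp: rsuq_map_eq k_def)
    \<comment> \<open>The lattice point is error plus input minus sample, which explains the radius
      \<open>\<tau> + r + D\<close>.\<close>
    have "norm (lattice_point G j) \<le> norm (?Q x - x) + norm x + norm (s (k x))"
      unfolding j using norm_triangle_ineq[of "s (k x) + lattice_point G j - x + x" "- s (k x)"]
        norm_triangle_ineq[of "s (k x) + lattice_point G j - x" "x"] by simp
    then have "j \<in> J"
      using e sk x unfolding J_def by simp
    then have card: "card J > 0"
      using fin card_gt_0_iff by blast
    have pmf_J: "pmf (pmf_of_set J) j = 1 / real (card J)"
      using \<open>j \<in> J\<close> fin by (subst pmf_of_set) auto
    have "(1 - \<theta>) ^ k x * \<theta> / real (card J) = pmf (pair_pmf (geometric_pmf \<theta>) (pmf_of_set J)) (k x, j)"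
      using th by (subst pmf_pair) (simp add: pmf_J)
    also have "\<dots> = measure_pmf.prob (pair_pmf (geometric_pmf \<theta>) (pmf_of_set J)) {(k x, j)}"
      by (simp add: measure_pmf_single)
    \<comment> \<open>Different pairs may yield the same output; \<open>q\<close> collects their
      masses, so only an inequality holds here, in the useful direction.\<close>
    also have "\<dots> \<le> measure_pmf.prob (pair_pmf (geometric_pmf \<theta>) (pmf_of_set J))
        ((\<lambda>(k, j). s k + lattice_point G j) -` {?Q x})"
      by (intro measure_pmf.finite_measure_mono) (auto simp: j)
    also have "\<dots> = pmf q (?Q x)"
      by (simp add: q_def pmf_map)
    finally show ?thesis
      using card by simp
  qed
  have pos_pmf: "(1 - \<theta>) ^ k x * \<theta> / real (card J) > 0" if "norm x \<le> \<tau>" for x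
    using bound[OF that] th by simp
  have ae: "AE x in ?M. norm x \<le> \<tau>"
    by (rule AE_uniform_measureI) auto
  have "shannon_entropy ?M ?Q \<le> (\<integral>\<^sup>+x. ennreal (- log 2 (pmf q (?Q x))) \<partial>?M)"
  proof (rule shannon_entropy_le_pmf[OF prob])
    show "countable (range ?Q)"
      by (rule countable_range_rsuq_map)
    show "?Q -` {y} \<inter> space ?M \<in> sets ?M" for y
      using measurable_sets[OF meas, of "{y}"] by simp
    show "AE x in ?M. 0 < pmf q (?Q x)"
      using ae by eventually_elim (use bound pos_pmf in \<open>blast intro: less_le_trans\<close>)
  qed simp
  also have "\<dots> \<le> (\<integral>\<^sup>+x. ennreal (log 2 (real (card J)) - log 2 \<theta> - real (k x) * log 2 (1 - \<theta>)) \<partial>?M)"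
  proof (rule nn_integral_mono_AE)
    show "AE x in ?M. ennreal (- log 2 (pmf q (?Q x)))
        \<le> ennreal (log 2 (real (card J)) - log 2 \<theta> - real (k x) * log 2 (1 - \<theta>))"
      using ae
    proof eventually_elim
      case (elim x)
      have "log 2 ((1 - \<theta>) ^ k x * \<theta> / real (card J)) \<le> log 2 (pmf q (?Q x))"
        using bound[OF elim] pos_pmf[OF elim] by (subst log_le_cancel_iff) auto
      moreover have "log 2 ((1 - \<theta>) ^ k x * \<theta> / real (card J))
          = real (k x) * log 2 (1 - \<theta>) + log 2 \<theta> - log 2 (real (card J))"
        using bound[OF elim] th by (simp add: log_divide log_mult log_nat_power)
      ultimately show ?case
        by (intro ennreal_leI) simp
    qed
  qed
  finally show ?thesis
    unfolding J_def k_def .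
qed

lemma nn_integral_first_hit_rsuq:
  "(\<integral>\<^sup>+s. ennreal (real (first_hit {w. err x w \<in> A} s)) \<partial>rsuq_law P) = ennreal ((1 - accept_prob) / accept_prob)"
proof -
  interpret iid_sequence U "{v. err x v \<in> A}"
    by (rule iid_err) simp
  show ?thesis
    using nn_integral_first_hit accept_prob_bounds by (simp add: rsuq_law_eq measure_U_err_A)
qed

text \<open>The bounds for single seeds are averaged. After exchanging the integrals, the mean index
  over seeds is the same for every input, and the average over inputs is trivial.\<close>

lemma quantizer_entropy_rsuq_le:
  assumes th: "0 < \<theta>" "\<theta> < 1"
    and seeds: "AE s in rsuq_law P. s \<in> rsuq_seeds G P A"
    and bnd: "A \<subseteq> cball 0 r" "P \<subseteq> cball 0 D" and pos: "\<tau> > 0" "r \<ge> 0" "D \<ge> 0"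
  shows "quantizer_entropy (uniform_measure lborel (cball 0 \<tau>)) (rsuq_law P) (rsuq_map G P A)
    \<le> ennreal (log 2 (real (card {j. norm (lattice_point G j) \<le> \<tau> + r + D})) - log 2 \<theta>
          - (1 - accept_prob) / accept_prob * log 2 (1 - \<theta>))"
proof -
  let ?M = "uniform_measure lborel (cball (0 :: real^'n) \<tau>)"
  let ?c = "log 2 (real (card {j. norm (lattice_point G j) \<le> \<tau> + r + D})) - log 2 \<theta>"
  let ?k = "\<lambda>x s. first_hit {w. err x w \<in> A} s"
  interpret S: prob_space "rsuq_law P"
    by (rule prob_space_rsuq_law)
  have vol: "emeasure lborel (cball (0 :: real^'n) \<tau>) = ennreal (measure lborel (cball (0 :: real^'n) \<tau>))"
    using emeasure_lborel_cball_finite[of "0 :: real^'n" \<tau>] by (intro emeasure_eq_ennreal_measure) auto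
  interpret X: prob_space ?M
    using pos by (intro prob_space_uniform_measure) (auto simp: vol content_cball_pos)
  interpret XS: pair_sigma_finite ?M "rsuq_law P" ..
  have c: "?c \<ge> 0"
  proof -
    let ?J = "{j. norm (lattice_point G j) \<le> \<tau> + r + D}"
    have "finite ?J"
      using finite_lattice_ball[OF rank, of 0] by simp
    moreover have "0 \<in> ?J"
      using pos by simp
    ultimately have "card ?J \<noteq> 0"
      by (metis card_0_eq empty_iff)
    then have "log 2 (real (card ?J)) \<ge> 0"
      by simp
    moreover have "log 2 \<theta> \<le> 0"
      using th by simp
    ultimately show ?thesis by linarith
  qed
  have b: "- log 2 (1 - \<theta>) \<ge> 0"
    using th by simp
  have split: "ennreal (?c - real (?k x s) * log 2 (1 - \<theta>))
      = ennreal ?c + ennreal (- log 2 (1 - \<theta>)) * ennreal (real (?k x s))" for x s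
  proof -
    have "ennreal (- log 2 (1 - \<theta>)) * ennreal (real (?k x s)) = ennreal (- log 2 (1 - \<theta>) * real (?k x s))"
      using b by (intro ennreal_mult[symmetric]) auto
    moreover have "- log 2 (1 - \<theta>) * real (?k x s) \<ge> 0"
      using b by (intro mult_nonneg_nonneg) auto
    ultimately show ?thesis
      using c by (simp flip: ennreal_plus add: mult.commute)
  qed
  have meas: "(\<lambda>(x, s). ennreal (?c - real (?k x s) * log 2 (1 - \<theta>))) \<in> borel_measurable (?M \<Otimes>\<^sub>M rsuq_law P)"
  proof -
    have "(\<lambda>(x, s). ?k x s) \<in> measurable (?M \<Otimes>\<^sub>M rsuq_law P) (count_space UNIV)"
      using measurable_first_hit_pair
      by (subst measurable_cong_sets[OF sets_pair_measure_cong[of ?M borel "rsuq_law P" "rsuq_law P"] refl]) simp_all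
    then have [measurable]: "(\<lambda>z. ?k (fst z) (snd z)) \<in> measurable (?M \<Otimes>\<^sub>M rsuq_law P) (count_space UNIV)"
      by (simp add: case_prod_unfold)
    show ?thesis
      unfolding case_prod_unfold by measurable
  qed
  have "quantizer_entropy ?M (rsuq_law P) (rsuq_map G P A)
      \<le> (\<integral>\<^sup>+s. \<integral>\<^sup>+x. ennreal (?c - real (?k x s) * log 2 (1 - \<theta>)) \<partial>?M \<partial>rsuq_law P)"
    unfolding quantizer_entropy_def
    by (rule nn_integral_mono_AE)
      (use seeds shannon_entropy_rsuq_le[OF th _ bnd pos(1)] in \<open>auto elim: eventually_mono\<close>)
  also have "\<dots> = (\<integral>\<^sup>+x. \<integral>\<^sup>+s. ennreal (?c - real (?k x s) * log 2 (1 - \<theta>)) \<partial>rsuq_law P \<partial>?M)"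
    by (rule XS.Fubini') (rule meas)
  also have "\<dots> = (\<integral>\<^sup>+x. ennreal (?c - (1 - accept_prob) / accept_prob * log 2 (1 - \<theta>)) \<partial>?M)"
  proof (rule nn_integral_cong)
    fix x
    have mk: "?k x \<in> measurable (rsuq_law P) (count_space UNIV)"
      using measurable_Pair2[OF measurable_first_hit_pair, of x] by simp
    have mk': "(\<lambda>s. ennreal (real (?k x s))) \<in> borel_measurable (rsuq_law P)"
      by (rule measurable_compose[OF mk]) simp
    have "(1 - accept_prob) / accept_prob \<ge> 0"
      using accept_prob_bounds by simp
    then have nn: "- log 2 (1 - \<theta>) * ((1 - accept_prob) / accept_prob) \<ge> 0"
      using b by (intro mult_nonneg_nonneg)
    have "(\<integral>\<^sup>+s. ennreal (?c - real (?k x s) * log 2 (1 - \<theta>)) \<partial>rsuq_law P)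
       = ennreal ?c + ennreal (- log 2 (1 - \<theta>)) * ennreal ((1 - accept_prob) / accept_prob)"
      unfolding split using mk' S.emeasure_space_1
      by (simp add: nn_integral_add nn_integral_cmult nn_integral_first_hit_rsuq)
    also have "\<dots> = ennreal (?c + - log 2 (1 - \<theta>) * ((1 - accept_prob) / accept_prob))"
      using b c nn \<open>(1 - accept_prob) / accept_prob \<ge> 0\<close> by (simp only: ennreal_mult ennreal_plus)
    also have "?c + - log 2 (1 - \<theta>) * ((1 - accept_prob) / accept_prob) = ?c - (1 - accept_prob) / accept_prob * log 2 (1 - \<theta>)"
      by simp
    finally show "(\<integral>\<^sup>+s. ennreal (?c - real (?k x s) * log 2 (1 - \<theta>)) \<partial>rsuq_law P)
       = ennreal (?c - (1 - accept_prob) / accept_prob * log 2 (1 - \<theta>))" .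
  qed
  also have "\<dots> = ennreal (?c - (1 - accept_prob) / accept_prob * log 2 (1 - \<theta>))"
    by (simp add: X.emeasure_space_1 del: space_uniform_measure)
  finally show ?thesis .
qed

text \<open>The parameter \<open>\<theta>\<close> is free because for \<open>accept_prob = 1\<close> the optimal value \<open>\<theta> = 1\<close> would give
  weight \<open>0\<close> to all stopping indices but the first; that case is reached as a limit.\<close>

lemma normalized_entropy_rsuq_le_geometric:
  assumes seeds: "AE s in rsuq_law P. s \<in> rsuq_seeds G P A"
  and th: "0 < \<theta>" "\<theta> < 1"
  and bnd: "A \<subseteq> cball 0 r" "r \<ge> 0"
  shows "normalized_entropy (rsuq_law P) (rsuq_map G P A)
    \<le> ereal (- log 2 (measure lborel P) - log 2 \<theta> - (1 - accept_prob) / accept_prob * log 2 (1 - \<theta>))"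
proof -
  obtain D where "D > 0" "\<forall>x\<in>P. norm x \<le> D"
    using bounded_cell bounded_pos by blast
  then have D: "P \<subseteq> cball 0 D" "D \<ge> 0"
    by auto
  define m where "m = measure lborel P"
  define b where "b = - log 2 \<theta> - (1 - accept_prob) / accept_prob * log 2 (1 - \<theta>)"
  \<comment> \<open>The counting radius exceeds \<tau> by \<open>r + D\<close>, and covering the
    cells around the counted points costs another \<open>D\<close>.\<close>
  define c where "c = r + 2 * D"
  define d where "d = CARD('n)"
  have m: "m > 0"
    using measure_P_pos by (simp add: m_def)
  have vol: "measure lborel (cball (0 :: real^'n) t) = unit_ball_vol (real d) * t ^ d" if "t \<ge> 0" for t
    using that content_cball[of t "0 :: real^'n"] by (simp add: d_def)
  have kpos: "unit_ball_vol (real d) > 0"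
    by (simp add: unit_ball_vol_pos)
  have b_nonneg: "b \<ge> 0"
  proof -
    have "(1 - accept_prob) / accept_prob * (- log 2 (1 - \<theta>)) \<ge> 0"
      using accept_prob_bounds th by (intro mult_nonneg_nonneg) auto
    moreover have "log 2 \<theta> \<le> 0"
      using th by simp
    ultimately show ?thesis
      unfolding b_def by simp
  qed
  \<comment> \<open>The first term is the logarithm of the volume ratio of the balls of radii
    \<open>\<tau> + c\<close> and \<tau>; it tends to 0.\<close>
  let ?F = "\<lambda>\<tau>::real. real d * log 2 ((\<tau> + c) / \<tau>) - log 2 m + b"
  have "normalized_entropy (rsuq_law P) (rsuq_map G P A) \<le> Limsup at_top (\<lambda>\<tau>. ereal (?F \<tau>))"
    unfolding normalized_entropy_def
  proof (rule Limsup_mono)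
    show "\<forall>\<^sub>F \<tau> in at_top. enn2ereal (quantizer_entropy (uniform_measure lborel (cball 0 \<tau>)) (rsuq_law P) (rsuq_map G P A))
        - ereal (log 2 (measure lborel (cball (0 :: real^'n) \<tau>))) \<le> ereal (?F \<tau>)"
      using eventually_gt_at_top[of "0::real"]
    proof eventually_elim
      case (elim \<tau>)
      define N where "N = real (card {j. norm (lattice_point G j) \<le> \<tau> + r + D})"
      have "N > 0"
      proof -
        have "finite {j. norm (lattice_point G j) \<le> \<tau> + r + D}"
          using finite_lattice_ball[OF rank, of 0] by simp
        moreover have "0 \<in> {j. norm (lattice_point G j) \<le> \<tau> + r + D}"
          using elim D bnd by simp
        ultimately show ?thesis
          unfolding N_def using card_gt_0_iff by (metis empty_iff of_nat_0_less_iff)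
      qed
      then have "N \<ge> 1"
        unfolding N_def by simp
      have "N * m \<le> unit_ball_vol (real d) * (\<tau> + c) ^ d"
        unfolding N_def m_def using card_lattice_ball_le[OF D(1), of "\<tau> + r + D"] elim D bnd
        by (subst vol[symmetric]) (auto simp: c_def add.assoc)
      then have "N \<le> unit_ball_vol (real d) * (\<tau> + c) ^ d / m"
        using m by (simp add: field_simps)
      then have "log 2 N \<le> log 2 (unit_ball_vol (real d) * (\<tau> + c) ^ d / m)"
        using \<open>N > 0\<close> by (subst log_le_cancel_iff) auto
      moreover have "\<tau> + c > 0"
        using elim D bnd by (simp add: c_def)
      ultimately have logN: "log 2 N - log 2 (unit_ball_vol (real d) * \<tau> ^ d) \<le> real d * log 2 ((\<tau> + c) / \<tau>) - log 2 m"
        using kpos m elim by (simp add: log_divide log_mult log_nat_power algebra_simps less_imp_neq[OF kpos, symmetric])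
      have "enn2ereal (quantizer_entropy (uniform_measure lborel (cball 0 \<tau>)) (rsuq_law P) (rsuq_map G P A))
          \<le> enn2ereal (ennreal (log 2 N + b))"
        using quantizer_entropy_rsuq_le[OF th seeds bnd(1) D(1) elim bnd(2) D(2)] unfolding less_eq_ennreal.rep_eq N_def b_def by (simp add: algebra_simps)
      \<comment> \<open>Nonnegativity matters, as \<open>ennreal\<close> would truncate a negative
        bound to 0; the origin is always counted, so \<open>N \<ge> 1\<close>.\<close>
      also have "\<dots> = ereal (log 2 N + b)"
        using \<open>N \<ge> 1\<close> b_nonneg by (intro enn2ereal_ennreal) simp
      finally have "enn2ereal (quantizer_entropy (uniform_measure lborel (cball 0 \<tau>)) (rsuq_law P) (rsuq_map G P A))
          - ereal (log 2 (measure lborel (cball (0 :: real^'n) \<tau>)))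
          \<le> ereal (log 2 N + b) - ereal (log 2 (measure lborel (cball (0 :: real^'n) \<tau>)))"
        by (intro ereal_minus_mono) auto
      also have "\<dots> \<le> ereal (?F \<tau>)"
        using logN elim by (simp add: vol)
      finally show ?case .
    qed
  qed
  also have "Limsup at_top (\<lambda>\<tau>. ereal (?F \<tau>)) = ereal (real d * log 2 1 - log 2 m + b)"
  proof (rule lim_imp_Limsup)
    have "((\<lambda>\<tau>::real. 1 + c / \<tau>) \<longlongrightarrow> 1 + 0) at_top"
      by (intro tendsto_intros tendsto_divide_0[OF tendsto_const]) (simp add: filterlim_at_top_imp_at_infinity filterlim_ident)
    moreover have "\<forall>\<^sub>F \<tau> in at_top. 1 + c / \<tau> = (\<tau> + c) / \<tau>"
      using eventually_gt_at_top[of "0::real"] by eventually_elim (simp add: field_simps)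
    ultimately have "((\<lambda>\<tau>. (\<tau> + c) / \<tau>) \<longlongrightarrow> 1) at_top"
      by (simp add: tendsto_cong)
    then have "(?F \<longlongrightarrow> real d * log 2 1 - log 2 m + b) at_top"
      by (intro tendsto_intros) auto
    then show "((\<lambda>\<tau>. ereal (?F \<tau>)) \<longlongrightarrow> ereal (real d * log 2 1 - log 2 m + b)) at_top"
      by simp
  qed simp
  also have "real d * log 2 1 - log 2 m + b
      = - log 2 (measure lborel P) - log 2 \<theta> - (1 - accept_prob) / accept_prob * log 2 (1 - \<theta>)"
    by (simp add: m_def b_def)
  finally show ?thesis .
qed

text \<open>Take \<theta> equal to \<open>accept_prob\<close>: its logarithm turns the volume of the
  cell into that of \<open>A\<close>.\<close>

lemma normalized_entropy_rsuq_le: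
  assumes seeds: "AE s in rsuq_law P. s \<in> rsuq_seeds G P A"
    and bnd: "A \<subseteq> cball 0 r" "r \<ge> 0"
  shows "normalized_entropy (rsuq_law P) (rsuq_map G P A)
    \<le> ereal (- log 2 (measure lborel A) - (1 - accept_prob) / accept_prob * log 2 (1 - accept_prob))"
proof -
  have log_A: "- log 2 (measure lborel A) = - log 2 (measure lborel P) - log 2 accept_prob"
    using measure_P_pos A_pos by (simp add: accept_prob_def log_divide)
  show ?thesis
  proof (cases "accept_prob < 1")
    case True
    then show ?thesis
      using normalized_entropy_rsuq_le_geometric[OF seeds _ True bnd] accept_prob_bounds
      unfolding log_A by simp
  next
    case False
    then have one: "accept_prob = 1"
      using accept_prob_bounds by simp
    \<comment> \<open>Here the mean index is 0, so the term with \<open>log 2 (1 - \<theta>)\<close>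
      vanishes for every \<theta> < 1, before the limit from the left is taken.\<close>
    have "normalized_entropy (rsuq_law P) (rsuq_map G P A) \<le> ereal (- log 2 (measure lborel P) - log 2 1)"
    proof (rule tendsto_lowerbound)
      show "((\<lambda>\<theta>. ereal (- log 2 (measure lborel P) - log 2 \<theta>))
          \<longlongrightarrow> ereal (- log 2 (measure lborel P) - log 2 1)) (at_left 1)"
        unfolding lim_ereal by (rule tendsto_diff[OF tendsto_const]) (rule tendsto_log; simp)
      show "\<forall>\<^sub>F \<theta> in at_left 1. normalized_entropy (rsuq_law P) (rsuq_map G P A)
          \<le> ereal (- log 2 (measure lborel P) - log 2 \<theta>)"
        using eventually_at_left_real[of 0 "1::real"]
        by (auto elim!: eventually_mono dest!: normalized_entropy_rsuq_le_geometric[OF seeds _ _ bnd] simp: one)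
    qed simp
    then show ?thesis
      unfolding log_A by (simp add: one)
  qed
qed

end

section \<open>Scaling the lattice and the final bounds\<close>

lemma det_scaleR:
  fixes G :: "real^'n^'n"
  shows "det (c *\<^sub>R G) = c ^ CARD('n) * det G"
proof -
  have "c *\<^sub>R G = (\<chi> i. c *s G $ i)"
    by (simp add: vec_eq_iff)
  then show ?thesis
    using det_rows_mul[of "\<lambda>_. c" "($) G"] by simp
qed

lemma rank_scaleR:
  fixes G :: "real^'n^'n"
  assumes "rank G = CARD('n)" "c \<noteq> 0"
  shows "rank (c *\<^sub>R G) = CARD('n)"
  using assms unfolding full_rank_injective inj_def
  by (simp add: scaleR_matrix_vector_assoc[symmetric])

text \<open>This is ln t <= t - 1 at t = 1 / (1 - \<delta>); the remaining factors cancel to 1. At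
  \<delta> = 1 the convention 0 log 0 = 0 applies.\<close>

lemma neg_log_compl_bound:
  fixes \<delta> :: real
  assumes "0 < \<delta>" "\<delta> \<le> 1"
  shows "- ((1 - \<delta>) / \<delta> * log 2 (1 - \<delta>)) \<le> log 2 (exp 1)"
proof (cases "\<delta> = 1")
  case False
  then have d: "0 < 1 - \<delta>"
    using assms by simp
  have "ln (1 / (1 - \<delta>)) \<le> 1 / (1 - \<delta>) - 1"
    using d by (intro ln_le_minus_one) simp
  also have "1 / (1 - \<delta>) - 1 = \<delta> / (1 - \<delta>)"
    using d by (simp add: field_simps)
  also have "ln (1 / (1 - \<delta>)) = - ln (1 - \<delta>)"
    using d by (simp add: ln_div)
  finally have "(1 - \<delta>) / \<delta> * (- ln (1 - \<delta>)) \<le> (1 - \<delta>) / \<delta> * (\<delta> / (1 - \<delta>))"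
    using d assms by (intro mult_left_mono) auto
  also have "\<dots> = 1"
    using d assms by simp
  finally have "(1 - \<delta>) / \<delta> * (- ln (1 - \<delta>)) / ln 2 \<le> 1 / ln 2"
    by (intro divide_right_mono) auto
  then show ?thesis
    by (simp add: log_def)
qed (simp add: log_def)

lemma cball_minus_null:
  assumes "ball 0 r \<subseteq> P" "P \<in> sets borel"
  shows "cball (0 :: 'a::euclidean_space) r - P \<in> null_sets lborel"
proof (rule null_sets_subset)
  show "sphere (0 :: 'a) r \<in> null_sets lborel"
    using negligible_sphere[of "0 :: 'a" r] by (simp add: negligible_iff_null_sets null_sets_completion_iff)
qed (use assms in \<open>auto simp: subset_iff le_less\<close>)

theorem corollary7:
  fixes G :: "real^'n::{finite,linorder}^'n::{finite,linorder}" and r n \<kappa> \<delta> :: real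
  assumes "r > 0" and "rank G = CARD('n)"
  defines "n \<equiv> real CARD('n)"
    and "\<kappa> \<equiv> measure lborel (cball (0 :: real^'n::{finite,linorder}) 1)"
    and "\<delta> \<equiv> packing_density G"
  shows
    "(\<exists>(G' :: real^'n::{finite,linorder}^'n::{finite,linorder}) S PS Q.
        is_rsuq G' (cball 0 r) (voronoi_cell G') S PS Q \<and>
        randomized_quantizer S PS Q \<and>
        normalized_entropy PS Q
          \<le> ereal (- n * log 2 r - log 2 \<kappa> - (1 - \<delta>) / \<delta> * log 2 (1 - \<delta>)) \<and>
        (\<forall>x. distr PS borel (\<lambda>s. Q x s - x) = uniform_measure lborel (cball 0 r)) \<and>
        max_error S Q = ereal r \<and>
        (\<forall>PX. prob_space PX \<and> sets PX = sets borel \<longrightarrow>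
           (\<integral>z. (norm (Q (fst z) (snd z) - fst z))\<^sup>2 \<partial>(PX \<Otimes>\<^sub>M PS)) = n * r\<^sup>2 / (n + 2))) \<and>
     - n * log 2 r - log 2 \<kappa> - (1 - \<delta>) / \<delta> * log 2 (1 - \<delta>)
       \<le> - n * log 2 r - log 2 \<kappa> + log 2 (exp 1)"
proof -
  define \<rho> where "\<rho> = packing_radius G"
  define c where "c = r / \<rho>"
  define G' where "G' = c *\<^sub>R G"
  let ?V = "voronoi_cell G'" and ?A = "cball (0 :: real^'n::{finite,linorder}) r"
  have \<rho>: "\<rho> > 0"
    unfolding \<rho>_def by (rule packing_radius_pos) fact
  then have c: "c > 0" "c * \<rho> = r"
    using \<open>r > 0\<close> by (simp_all add: c_def)
  have rank: "rank G' = CARD('n)"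
    unfolding G'_def using assms(2) c(1) by (intro rank_scaleR) auto
  have "2 * r \<le> norm (lattice_point G' j)" if "j \<noteq> 0" for j
  proof -
    have "c * (2 * \<rho>) \<le> c * norm (lattice_point G j)"
      using packing_radius_le[OF that, of G] c(1) unfolding \<rho>_def by (intro mult_left_mono) auto
    moreover have "c * (2 * \<rho>) = 2 * r"
      using c(2) by simp
    ultimately show ?thesis
      using c(1) by (simp only: G'_def lattice_point_scaleR norm_scaleR abs_of_pos)
  qed
  then have ball_V: "ball 0 r \<subseteq> ?V"
    by (rule ball_subset_voronoi)
  have vol_A: "measure lborel ?A = \<kappa> * r ^ CARD('n)"
    using \<open>r > 0\<close> by (simp add: \<kappa>_def content_cball)
  have \<kappa>: "\<kappa> > 0"
    unfolding \<kappa>_def by (rule content_cball_pos) simp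
  interpret rsuq_cell G' ?V ?A
    using rank basic_cell_voronoi[OF rank] borel_voronoi[of G'] ball_V \<open>r > 0\<close>
    by unfold_locales (auto intro: cball_minus_null content_cball_pos)
  have seeds: "AE s in rsuq_law ?V. s \<in> rsuq_seeds G' ?V ?A"
    using \<open>r > 0\<close> ball_V by (intro AE_rsuq_seeds[of r]) auto
  have "measure lborel ?V = c ^ CARD('n) * \<bar>det G\<bar>"
    using emeasure_cell c(1) by (simp add: measure_def G'_def det_scaleR abs_mult)
  \<comment> \<open>With r = c \<rho>, the factor c^n cancels between the volumes of the ball and of
    the scaled cell: density is invariant under scaling.\<close>
  then have accept: "accept_prob = \<delta>"
    using c unfolding accept_prob_def vol_A \<delta>_def packing_density_def \<rho>_def[symmetric] \<kappa>_def[symmetric]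
    by (simp add: c(2)[symmetric] power_mult_distrib)
  have log_A: "log 2 (measure lborel ?A) = n * log 2 r + log 2 \<kappa>"
    unfolding vol_A n_def using \<open>r > 0\<close> \<kappa> by (simp add: log_mult log_nat_power)
  have "is_rsuq G' ?A ?V (rsuq_seeds G' ?V ?A) (rsuq_law ?V) (rsuq_map G' ?V ?A)"
    unfolding is_rsuq_def using rank cell borel_P borel_A A_null by simp
  moreover have "randomized_quantizer (rsuq_seeds G' ?V ?A) (rsuq_law ?V) (rsuq_map G' ?V ?A)"
    unfolding randomized_quantizer_def
    using prob_space_rsuq_law seeds measurable_rsuq_map countable_range_rsuq_map by simp
  moreover have "normalized_entropy (rsuq_law ?V) (rsuq_map G' ?V ?A)
      \<le> ereal (- n * log 2 r - log 2 \<kappa> - (1 - \<delta>) / \<delta> * log 2 (1 - \<delta>))"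
    using normalized_entropy_rsuq_le[OF seeds subset_refl] \<open>r > 0\<close> by (simp add: log_A accept)
  moreover have "max_error (rsuq_seeds G' ?V ?A) (rsuq_map G' ?V ?A) = ereal r"
    using \<open>r > 0\<close> ball_V by (intro max_error_rsuq) auto
  moreover have "enn2real (\<integral>\<^sup>+e. ennreal ((norm e)\<^sup>2) \<partial>uniform_measure lborel ?A) = n * r\<^sup>2 / (n + 2)"
    using \<open>r > 0\<close> by (subst nn_integral_norm_sq_ball) (auto simp: n_def)
  \<comment> \<open>The range 0 < \<delta> <= 1 required here comes from \<delta> being an
    acceptance probability.\<close>
  moreover have "- n * log 2 r - log 2 \<kappa> - (1 - \<delta>) / \<delta> * log 2 (1 - \<delta>)
       \<le> - n * log 2 r - log 2 \<kappa> + log 2 (exp 1)"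
    using neg_log_compl_bound[of \<delta>] accept_prob_bounds unfolding accept by simp
  ultimately show ?thesis
    using distr_rsuq_err mse_rsuq by (intro conjI exI[of _ G'] exI) auto
qed

end
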